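(* Let $G=(V,E)$ be a graph and let $x\in V$ be given. Then $\mathrm{reg}(\mathcal{L}_x(G))=\mathrm{reg}(G)+1$, where $\mathcal{L}_x(G)$ is the Lozin's transform of $G$ with respect to the vertex $x$.
   Context: Graphs are finite, simple and undirected. For a simplicial complex $\Delta$ on vertex set $V$ and a field $\mathbf{k}$, the Castelnuovo-Mumford regularity is $\mathrm{reg}_{\mathbf{k}}(\Delta)=\max\{j : \widetilde{H}_{j-1}(\Delta[S];\mathbf{k})\neq 0 \text{ for some } S\subseteq V\}$, where $\Delta[S]$ is the induced subcomplex on $S$ and $\widetilde{H}_*$ is reduced homology; the field is suppressed from notation. The regularity of a graph $G$ is $\mathrm{reg}(G):=\mathrm{reg}(\mathcal{I}(G))$, where $\mathcal{I}(G)$ is the independence complex of $G$. The Lozin's transform $\mathcal{L}_x(G)$ is obtained by: partitioning $N_G(x)$ into two (possibly empty) subsets $Y$ and $Z$ arbitrarily; deleting $x$ with its incident edges; adding a path $P_4$ with vertices $y,a,b,z$ and edges $ya,ab,bz$; and joining $y$ to every vertex of $Y$ and $z$ to every vertex of $Z$. *)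

theory Defs
  imports Main "HOL-Algebra.Coset"
begin

section \<open>Graphs and the Lozin transform\<close>

definition simple_graph :: "'a set \<Rightarrow> 'a set set \<Rightarrow> bool" where
  "simple_graph V E \<longleftrightarrow> finite V \<and> (\<forall>e\<in>E. e \<subseteq> V \<and> card e = 2)"

definition neighbourhood :: "'a set set \<Rightarrow> 'a \<Rightarrow> 'a set" where
  "neighbourhood E x = {v. {x, v} \<in> E}"

definition lozin_verts :: "'a set \<Rightarrow> 'a \<Rightarrow> 'a \<Rightarrow> 'a \<Rightarrow> 'a \<Rightarrow> 'a \<Rightarrow> 'a set" where
  "lozin_verts V x y a b z = (V - {x}) \<union> {y, a, b, z}"

definition lozin_edges ::
    "'a set set \<Rightarrow> 'a \<Rightarrow> 'a set \<Rightarrow> 'a set \<Rightarrow> 'a \<Rightarrow> 'a \<Rightarrow> 'a \<Rightarrow> 'a \<Rightarrow> 'a set set" where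
  "lozin_edges E x Y Z y a b z =
     {e \<in> E. x \<notin> e} \<union> {{y, a}, {a, b}, {b, z}} \<union> {{y, v} | v. v \<in> Y} \<union> {{z, v} | v. v \<in> Z}"


section \<open>Reduced simplicial homology with field coefficients\<close>

text \<open>
  A simplicial complex is a down-closed set of finite sets, containing the empty face.
  The oriented simplex \<open>[v\<^sub>0, \<dots>, v\<^sub>n]\<close> is the list of its vertices, and an oriented \<open>n\<close>-chain is
  given by its coefficients: a function on orderings of \<open>n\<close>-faces which changes sign under each
  transposition of two vertices. The empty list is the only \<open>(-1)\<close>-simplex, so that the
  augmentation is part of the complex.
\<close>

definition oriented_chains :: "'a set set \<Rightarrow> int \<Rightarrow> ('a list \<Rightarrow> 'k::field) set" where
  "oriented_chains \<Delta> n = {c.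
     (\<forall>xs. c xs \<noteq> 0 \<longrightarrow> distinct xs \<and> set xs \<in> \<Delta> \<and> int (length xs) = n + 1) \<and>
     (\<forall>xs i j. i < j \<and> j < length xs \<longrightarrow> c (xs[i := xs ! j, j := xs ! i]) = - c xs)}"

text \<open>
  From \<open>\<partial>[v\<^sub>0, \<dots>, v\<^sub>n] = (\<Sum>i\<le>n. (-1)^i [v\<^sub>0, \<dots>, v\<^sub>i\<^sub>-\<^sub>1, v\<^sub>i\<^sub>+\<^sub>1, \<dots>, v\<^sub>n])\<close>: a simplex having \<open>ys\<close> as a
  facet is, up to orientation, \<open>v # ys\<close> for one vertex \<open>v\<close>, and \<open>\<partial>(v # ys)\<close> has coefficient \<open>1\<close>
  at \<open>ys\<close>.
\<close>

definition chain_bd :: "'a set set \<Rightarrow> ('a list \<Rightarrow> 'k::field) \<Rightarrow> 'a list \<Rightarrow> 'k" where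
  "chain_bd \<Delta> c = (\<lambda>ys. \<Sum>v\<in>\<Union>\<Delta>. c (v # ys))"

definition cycle_group :: "'a set set \<Rightarrow> int \<Rightarrow> ('a list \<Rightarrow> 'k::field) monoid" where
  "cycle_group \<Delta> n =
     \<lparr>carrier = {c \<in> oriented_chains \<Delta> n. chain_bd \<Delta> c = (\<lambda>_. 0)},
      monoid.mult = (\<lambda>c d xs. c xs + d xs),
      one = (\<lambda>_. 0)\<rparr>"

definition boundaries :: "'a set set \<Rightarrow> int \<Rightarrow> ('a list \<Rightarrow> 'k::field) set" where
  "boundaries \<Delta> n = chain_bd \<Delta> ` oriented_chains \<Delta> (n + 1)"

definition reduced_homology :: "'a set set \<Rightarrow> int \<Rightarrow> ('a list \<Rightarrow> 'k::field) set monoid" where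
  "reduced_homology \<Delta> n = cycle_group \<Delta> n Mod boundaries \<Delta> n"

lemma sum_alternating_eq_0:
  fixes f :: "'a \<Rightarrow> 'a \<Rightarrow> 'k::ab_group_add"
  assumes alt: "\<And>v w. f v w = - f w v" and diag: "\<And>v. f v v = 0"
  shows "(\<Sum>v\<in>U. \<Sum>w\<in>U. f v w) = 0"
proof (cases "finite U")
  case True
  then show ?thesis
  proof (induction U)
    case (insert u U)
    have "(\<Sum>v\<in>U. f v u) = - (\<Sum>w\<in>U. f u w)"
      unfolding sum_negf[symmetric] by (intro sum.cong refl alt)
    with insert show ?case
      by (simp add: sum.distrib diag)
  qed simp
qed simp

lemma chain_bd_chain_bd:
  assumes "c \<in> oriented_chains \<Delta> n"
  shows "chain_bd \<Delta> (chain_bd \<Delta> c) = (\<lambda>_. 0 :: 'k::field)"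
proof
  fix ys
  have "c (w # v # ys) = - c (v # w # ys)" for v w
  proof -
    have "0 < (1::nat) \<and> 1 < length (v # w # ys) \<longrightarrow>
        c ((v # w # ys)[0 := (v # w # ys) ! 1, 1 := (v # w # ys) ! 0]) = - c (v # w # ys)"
      using assms unfolding oriented_chains_def by blast
    then show ?thesis by simp
  qed
  moreover have "c (v # v # ys) = 0" for v
    using assms by (auto simp: oriented_chains_def)
  ultimately show "chain_bd \<Delta> (chain_bd \<Delta> c) ys = 0"
    unfolding chain_bd_def by (rule sum_alternating_eq_0)
qed

lemma chain_bd_in_chains:
  assumes c: "c \<in> oriented_chains \<Delta> (n + 1)"
    and down: "\<And>\<sigma> \<tau>. \<sigma> \<in> \<Delta> \<Longrightarrow> \<tau> \<subseteq> \<sigma> \<Longrightarrow> \<tau> \<in> \<Delta>"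
  shows "chain_bd \<Delta> c \<in> (oriented_chains \<Delta> n :: ('a list \<Rightarrow> 'k::field) set)"
proof -
  have "distinct ys \<and> set ys \<in> \<Delta> \<and> int (length ys) = n + 1" if "chain_bd \<Delta> c ys \<noteq> 0" for ys
  proof -
    from that obtain v where "c (v # ys) \<noteq> 0"
      unfolding chain_bd_def by (meson sum.neutral)
    then have "distinct (v # ys) \<and> set (v # ys) \<in> \<Delta> \<and> int (length (v # ys)) = n + 1 + 1"
      using c unfolding oriented_chains_def by blast
    then show ?thesis using down[of "set (v # ys)" "set ys"] by auto
  qed
  moreover have "chain_bd \<Delta> c (xs[i := xs ! j, j := xs ! i]) = - chain_bd \<Delta> c xs"
    if ij: "i < j" "j < length xs" for xs i j
  proof -
    have "c (v # xs[i := xs ! j, j := xs ! i]) = - c (v # xs)" for v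
    proof -
      have "Suc i < Suc j \<and> Suc j < length (v # xs) \<longrightarrow>
          c ((v # xs)[Suc i := (v # xs) ! Suc j, Suc j := (v # xs) ! Suc i]) = - c (v # xs)"
        using c unfolding oriented_chains_def by blast
      then show ?thesis using ij by simp
    qed
    then show ?thesis by (simp add: chain_bd_def sum_negf)
  qed
  ultimately show ?thesis by (simp add: oriented_chains_def)
qed

lemma oriented_chains_add:
  assumes "c \<in> oriented_chains \<Delta> n" "d \<in> oriented_chains \<Delta> n"
  shows "(\<lambda>xs. c xs + d xs) \<in> (oriented_chains \<Delta> n :: ('a list \<Rightarrow> 'k::field) set)"
proof -
  have "distinct xs \<and> set xs \<in> \<Delta> \<and> int (length xs) = n + 1" if "c xs + d xs \<noteq> 0" for xs
  proof -
    from that have "c xs \<noteq> 0 \<or> d xs \<noteq> 0" by auto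
    with assms show ?thesis unfolding oriented_chains_def by blast
  qed
  with assms show ?thesis by (simp add: oriented_chains_def)
qed

lemma comm_group_cycle_group: "comm_group (cycle_group \<Delta> n :: ('a list \<Rightarrow> 'k::field) monoid)"
proof -
  let ?C = "{c \<in> oriented_chains \<Delta> n. chain_bd \<Delta> c = (\<lambda>_. 0 :: 'k)}"
  have add: "(\<lambda>xs. c xs + d xs) \<in> ?C" if "c \<in> ?C" "d \<in> ?C" for c d
  proof -
    have "chain_bd \<Delta> (\<lambda>xs. c xs + d xs) = (\<lambda>ys. chain_bd \<Delta> c ys + chain_bd \<Delta> d ys)"
      by (simp add: chain_bd_def sum.distrib)
    moreover have "(\<lambda>xs. c xs + d xs) \<in> oriented_chains \<Delta> n"
      using that by (intro oriented_chains_add) auto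
    ultimately show ?thesis using that by simp
  qed
  have neg: "(\<lambda>xs. - c xs) \<in> ?C" if "c \<in> ?C" for c
  proof -
    have "chain_bd \<Delta> (\<lambda>xs. - c xs) = (\<lambda>ys. - chain_bd \<Delta> c ys)"
      by (simp add: chain_bd_def sum_negf)
    then show ?thesis using that by (simp add: oriented_chains_def)
  qed
  have zero: "(\<lambda>_. 0) \<in> ?C" by (simp add: oriented_chains_def chain_bd_def)
  show ?thesis
  proof (rule comm_groupI)
    fix c :: "'a list \<Rightarrow> 'k" assume "c \<in> carrier (cycle_group \<Delta> n)"
    then show "\<exists>d\<in>carrier (cycle_group \<Delta> n). d \<otimes>\<^bsub>cycle_group \<Delta> n\<^esub> c = \<one>\<^bsub>cycle_group \<Delta> n\<^esub>"
      using neg[of c] unfolding cycle_group_def by (intro bexI[of _ "\<lambda>xs. - c xs"]) auto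
  qed (use add zero in \<open>simp_all add: cycle_group_def add_ac\<close>)
qed

lemma subgroup_boundaries:
  assumes down: "\<And>\<sigma> \<tau>. \<sigma> \<in> \<Delta> \<Longrightarrow> \<tau> \<subseteq> \<sigma> \<Longrightarrow> \<tau> \<in> \<Delta>"
  shows "subgroup (boundaries \<Delta> n) (cycle_group \<Delta> n :: ('a list \<Rightarrow> 'k::field) monoid)"
proof -
  interpret comm_group "cycle_group \<Delta> n :: ('a list \<Rightarrow> 'k) monoid"
    by (rule comm_group_cycle_group)
  have sub: "boundaries \<Delta> n \<subseteq> carrier (cycle_group \<Delta> n :: ('a list \<Rightarrow> 'k) monoid)"
  proof
    fix c :: "'a list \<Rightarrow> 'k" assume "c \<in> boundaries \<Delta> n"
    then obtain d where d: "d \<in> oriented_chains \<Delta> (n + 1)" "c = chain_bd \<Delta> d"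
      by (auto simp: boundaries_def)
    show "c \<in> carrier (cycle_group \<Delta> n)"
      using chain_bd_in_chains[OF d(1) down] chain_bd_chain_bd[OF d(1)]
      by (simp add: cycle_group_def d(2))
  qed
  have zero: "(\<lambda>_. 0) \<in> (oriented_chains \<Delta> (n + 1) :: ('a list \<Rightarrow> 'k) set)"
    by (simp add: oriented_chains_def)
  show ?thesis
  proof (rule subgroupI[OF sub])
    show "boundaries \<Delta> n \<noteq> ({} :: ('a list \<Rightarrow> 'k) set)"
      using zero by (auto simp: boundaries_def)
  next
    fix c :: "'a list \<Rightarrow> 'k" assume c: "c \<in> boundaries \<Delta> n"
    then obtain d where d: "d \<in> oriented_chains \<Delta> (n + 1)" "c = chain_bd \<Delta> d"
      by (auto simp: boundaries_def)
    have "(\<lambda>xs. - d xs) \<in> oriented_chains \<Delta> (n + 1)"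
      using d(1) by (simp add: oriented_chains_def)
    moreover have "chain_bd \<Delta> (\<lambda>xs. - d xs) = (\<lambda>ys. - c ys)"
      by (simp add: d(2) chain_bd_def sum_negf)
    ultimately have m: "(\<lambda>ys. - c ys) \<in> boundaries \<Delta> n"
      unfolding boundaries_def by (metis imageI)
    have "inv\<^bsub>cycle_group \<Delta> n\<^esub> c = (\<lambda>ys. - c ys)"
    proof (rule inv_equality)
      show "(\<lambda>ys. - c ys) \<otimes>\<^bsub>cycle_group \<Delta> n\<^esub> c = \<one>\<^bsub>cycle_group \<Delta> n\<^esub>"
        by (simp add: cycle_group_def)
    qed (use sub c m in auto)
    with m show "inv\<^bsub>cycle_group \<Delta> n\<^esub> c \<in> boundaries \<Delta> n" by simp
  next
    fix c1 c2 :: "'a list \<Rightarrow> 'k" assume "c1 \<in> boundaries \<Delta> n" "c2 \<in> boundaries \<Delta> n"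
    then obtain d1 d2 where d: "d1 \<in> oriented_chains \<Delta> (n + 1)" "c1 = chain_bd \<Delta> d1"
        "d2 \<in> oriented_chains \<Delta> (n + 1)" "c2 = chain_bd \<Delta> d2"
      by (auto simp: boundaries_def)
    have "(\<lambda>xs. d1 xs + d2 xs) \<in> oriented_chains \<Delta> (n + 1)"
      using d(1,3) by (rule oriented_chains_add)
    moreover have "chain_bd \<Delta> (\<lambda>xs. d1 xs + d2 xs) = c1 \<otimes>\<^bsub>cycle_group \<Delta> n\<^esub> c2"
      by (simp add: d(2,4) chain_bd_def sum.distrib cycle_group_def)
    ultimately show "c1 \<otimes>\<^bsub>cycle_group \<Delta> n\<^esub> c2 \<in> boundaries \<Delta> n"
      unfolding boundaries_def by (metis imageI)
  qed
qed

lemma comm_group_reduced_homology: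
  assumes "\<And>\<sigma> \<tau>. \<sigma> \<in> \<Delta> \<Longrightarrow> \<tau> \<subseteq> \<sigma> \<Longrightarrow> \<tau> \<in> \<Delta>"
  shows "comm_group (reduced_homology \<Delta> n :: ('a list \<Rightarrow> 'k::field) set monoid)"
  unfolding reduced_homology_def
  by (rule comm_group.abelian_FactGroup[OF comm_group_cycle_group subgroup_boundaries[OF assms]])


section \<open>Castelnuovo-Mumford regularity\<close>

definition induced_subcomplex :: "'a set set \<Rightarrow> 'a set \<Rightarrow> 'a set set" where
  "induced_subcomplex \<Delta> S = {\<sigma> \<in> \<Delta>. \<sigma> \<subseteq> S}"

text \<open>The field is the type \<open>'k\<close>, passed as \<open>TYPE('k)\<close>.\<close>

definition complex_reg :: "'k::field itself \<Rightarrow> 'a set \<Rightarrow> 'a set set \<Rightarrow> nat" where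
  "complex_reg _ V \<Delta> = Max {j. \<exists>S\<subseteq>V.
     carrier (reduced_homology (induced_subcomplex \<Delta> S) (int j - 1) :: ('a list \<Rightarrow> 'k) set monoid)
       \<noteq> {\<one>\<^bsub>reduced_homology (induced_subcomplex \<Delta> S) (int j - 1)\<^esub>}}"

definition independence_complex :: "'a set \<Rightarrow> 'a set set \<Rightarrow> 'a set set" where
  "independence_complex V E = {A. A \<subseteq> V \<and> (\<forall>u\<in>A. \<forall>v\<in>A. {u, v} \<notin> E)}"

definition graph_reg :: "'k::field itself \<Rightarrow> 'a set \<Rightarrow> 'a set set \<Rightarrow> nat" where
  "graph_reg k V E = complex_reg k V (independence_complex V E)"

end

theory Submission
  imports Defs "HOL-Combinatorics.Transposition"
begin

text \<open>
  Two facts about the vanishing of reduced homology carry the proof. First, if the faces of \<open>\<Delta>\<close>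
  outside a subcomplex \<open>\<Delta>'\<close> are matched by toggling one vertex, then \<open>\<Delta>\<close> and \<open>\<Delta>'\<close> vanish in the
  same degrees. Second, the long exact sequence of deletion and link: vanishing for both gives
  vanishing for the complex, and if the deletion is acyclic then the homology is that of the link
  shifted by one.

  Toggling \<open>b\<close> and then \<open>a\<close> shows that the independence complex of the Lozin transform does not
  change its homology if all neighbours of \<open>z\<close> are moved to \<open>y\<close>. Then \<open>z\<close> is a leaf attached to
  \<open>b\<close>, and the link of \<open>b\<close> is a copy of the independence complex of \<open>G\<close> with \<open>y\<close> in the role of \<open>x\<close>.
  So the homology of every induced subgraph containing \<open>x\<close> reappears one degree higher; for a
  subgraph avoiding \<open>x\<close> one adds the edge \<open>ab\<close>. Conversely, every induced subgraph of the transform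
  reduces to induced subgraphs of \<open>G\<close> by removing vertices among \<open>y, a, b, z\<close>, at the cost of at most
  one degree.
\<close>

section \<open>Alternating functions on lists\<close>

text \<open>Only swaps of neighbouring entries are demanded, a form suited to list induction. They
  generate all transpositions, so this is the sign condition of \<open>oriented_chains\<close>; see
  \<open>oriented_chains_iff\<close>.\<close>

definition alternating :: "('a list \<Rightarrow> 'k::field) \<Rightarrow> bool" where
  "alternating c \<longleftrightarrow> (\<forall>as u w bs. c (as @ u # w # bs) = - c (as @ w # u # bs))"

lemma alternatingD: "alternating c \<Longrightarrow> c (as @ u # w # bs) = - c (as @ w # u # bs)"
  unfolding alternating_def by blast

lemma alternating_move:
  assumes "alternating c"
  shows "c (as @ u # ms @ bs) = (-1) ^ length ms * c (as @ ms @ u # bs)"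
proof (induction ms arbitrary: as)
  case (Cons m ms)
  have "c (as @ u # (m # ms) @ bs) = - c ((as @ [m]) @ u # ms @ bs)"
    using alternatingD[OF assms, of as u m "ms @ bs"] by simp
  also have "\<dots> = (-1) ^ length (m # ms) * c (as @ (m # ms) @ u # bs)"
    using Cons.IH[of "as @ [m]"] by simp
  finally show ?case .
qed simp

lemma alternating_swap:
  assumes "alternating c" "i < j" "j < length xs"
  shows "c (xs[i := xs ! j, j := xs ! i]) = - c xs"
proof -
  define as ms bs u w where "as = take i xs" and "ms = take (j - Suc i) (drop (Suc i) xs)"
    and "bs = drop (Suc j) xs" and "u = xs ! i" and "w = xs ! j"
  have "drop (Suc i) xs = ms @ w # bs"
    using assms(2,3) id_take_nth_drop[of "j - Suc i" "drop (Suc i) xs"]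
    by (simp add: ms_def bs_def w_def)
  then have xs: "xs = as @ u # ms @ w # bs"
    using assms(2,3) id_take_nth_drop[of i xs] by (simp add: as_def u_def)
  have len: "length as = i" "length ms = j - Suc i"
    using assms(2,3) by (simp_all add: as_def ms_def)
  have "xs[i := w, j := u] = as @ w # ms @ u # bs"
  proof -
    have j: "j = length as + Suc (length ms)" using assms(2) len by simp
    show ?thesis unfolding j len(1)[symmetric] by (simp add: xs list_update_append)
  qed
  \<comment> \<open>Both \<open>u\<close> and \<open>w\<close> cross \<open>ms\<close>, so the two
    signs \<open>(-1) ^ length ms\<close> cancel, and the one adjacent swap of \<open>u\<close> and
    \<open>w\<close> leaves a minus.\<close>
  moreover have "c (as @ w # ms @ u # bs) = - c (as @ u # ms @ w # bs)"
    using alternating_move[OF assms(1), of as w ms "u # bs"]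
      alternating_move[OF assms(1), of as u ms "w # bs"]
      alternatingD[OF assms(1), of "as @ ms" u w bs] by simp
  ultimately show ?thesis by (metis u_def w_def xs)
qed

lemma oriented_chains_iff:
  fixes c :: "'a list \<Rightarrow> 'k::field"
  shows "c \<in> oriented_chains \<Delta> n \<longleftrightarrow> alternating c \<and>
     (\<forall>xs. c xs \<noteq> 0 \<longrightarrow> distinct xs \<and> set xs \<in> \<Delta> \<and> int (length xs) = n + 1)"
proof -
  have "alternating c" if "c \<in> oriented_chains \<Delta> n"
    unfolding alternating_def
  proof (intro allI)
    fix as bs :: "'a list" and u w
    let ?xs = "as @ w # u # bs" and ?i = "length as"
    have "?i < Suc ?i \<and> Suc ?i < length ?xs \<longrightarrow>
        c (?xs[?i := ?xs ! Suc ?i, Suc ?i := ?xs ! ?i]) = - c ?xs"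
      using that unfolding oriented_chains_def by blast
    then show "c (as @ u # w # bs) = - c ?xs"
      by (simp add: list_update_append nth_append)
  qed
  then show ?thesis
    unfolding oriented_chains_def using alternating_swap[of c] by blast
qed

lemma oriented_chains_alternating: "c \<in> oriented_chains \<Delta> n \<Longrightarrow> alternating c"
  by (simp add: oriented_chains_iff)

lemma oriented_chains_support:
  assumes "c \<in> oriented_chains \<Delta> n" "c xs \<noteq> 0"
  shows "distinct xs" "set xs \<in> \<Delta>" "int (length xs) = n + 1"
  using assms by (auto simp: oriented_chains_iff)

lemma oriented_chainsI:
  assumes "alternating c"
    and "\<And>xs. c xs \<noteq> 0 \<Longrightarrow> distinct xs \<and> set xs \<in> \<Delta> \<and> int (length xs) = n + 1"
  shows "c \<in> oriented_chains \<Delta> n"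
  using assms by (simp add: oriented_chains_iff)

lemma oriented_chains_mono: "\<Delta>' \<subseteq> \<Delta> \<Longrightarrow> oriented_chains \<Delta>' n \<subseteq> oriented_chains \<Delta> n"
  unfolding oriented_chains_iff subset_iff by blast

lemma oriented_chains_uminus:
  "c \<in> oriented_chains \<Delta> n \<Longrightarrow> (\<lambda>xs. - c xs) \<in> oriented_chains \<Delta> n"
  by (simp add: oriented_chains_def)

lemma oriented_chains_diff:
  "c \<in> oriented_chains \<Delta> n \<Longrightarrow> d \<in> oriented_chains \<Delta> n \<Longrightarrow>
     (\<lambda>xs. c xs - d xs) \<in> oriented_chains \<Delta> n"
  using oriented_chains_add[OF _ oriented_chains_uminus, of c \<Delta> n d] by simp

lemma alternating_Cons: "alternating c \<Longrightarrow> alternating (\<lambda>xs. c (v # xs))"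
  unfolding alternating_def by (metis append_Cons)

lemma alternating_restrict:
  fixes c :: "'a list \<Rightarrow> 'k::field"
  assumes "alternating c"
  shows "alternating (\<lambda>xs. if P (set xs) then c xs else 0)"
  unfolding alternating_def
proof (intro allI)
  fix as bs :: "'a list" and u w
  have "set (as @ u # w # bs) = set (as @ w # u # bs)" by auto
  then show "(if P (set (as @ u # w # bs)) then c (as @ u # w # bs) else 0) =
      - (if P (set (as @ w # u # bs)) then c (as @ w # u # bs) else 0)"
    using alternatingD[OF assms, of as u w bs] by (simp del: set_append set_simps)
qed

lemma alternating_zero_moved:
  assumes "alternating c" "c (v # as @ bs) = 0"
  shows "c (as @ v # bs) = 0"
  using alternating_move[OF assms(1), of "[]" v as bs] assms(2) by simp

section \<open>The cone operator\<close>

text \<open>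
  The coefficients of the chain \<open>v * c\<close>: a list in which \<open>v\<close> occurs at position \<open>i\<close> gets the sign
  \<open>(-1)^i\<close> times the value of \<open>c\<close> on the list with \<open>v\<close> removed.
\<close>

fun cone_chain :: "'a \<Rightarrow> ('a list \<Rightarrow> 'k::field) \<Rightarrow> 'a list \<Rightarrow> 'k" where
  "cone_chain v c [] = 0"
| "cone_chain v c (u # xs) = (if u = v then c xs else - cone_chain v (\<lambda>ys. c (u # ys)) xs)"

lemma cone_chain_uminus: "cone_chain v (\<lambda>xs. - c xs) xs = - cone_chain v c xs"
  by (induction xs arbitrary: c) auto

lemma cone_chain_notin: "v \<notin> set xs \<Longrightarrow> cone_chain v c xs = 0"
  by (induction xs arbitrary: c) auto

lemma alternating_cone_chain:
  assumes "alternating c" "\<And>xs. v \<in> set xs \<Longrightarrow> c xs = 0"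
  shows "alternating (cone_chain v c)"
proof -
  have "cone_chain v c (as @ u # w # bs) = - cone_chain v c (as @ w # u # bs)" for as u w bs
    using assms
  proof (induction as arbitrary: c)
    case Nil
    have "(\<lambda>ys. c (u # w # ys)) = (\<lambda>ys. - c (w # u # ys))"
      using alternatingD[OF Nil(1), of "[]" u w] by (intro ext) simp
    \<comment> \<open>For \<open>u = w = v\<close> the claim reads
      \<open>c (v # bs) = - c (v # bs)\<close>; it holds since \<open>c\<close> vanishes on lists
      containing \<open>v\<close>.\<close>
    then show ?case using Nil(2) by (simp add: cone_chain_uminus)
  next
    case (Cons m as)
    show ?case
      using Cons.IH[of "\<lambda>ys. c (m # ys)"] Cons.prems
        alternatingD[OF Cons.prems(1), of as u w bs] by (simp add: alternating_Cons)
  qed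
  then show ?thesis unfolding alternating_def by blast
qed

lemma cone_chain_support:
  assumes "cone_chain v c xs \<noteq> 0"
  shows "\<exists>as bs. xs = as @ v # bs \<and> c (as @ bs) \<noteq> 0"
  using assms
proof (induction xs arbitrary: c)
  case (Cons u xs)
  show ?case
  proof (cases "u = v")
    case True
    then show ?thesis using Cons.prems by (intro exI[of _ "[]"] exI[of _ xs]) simp
  next
    case False
    then have "cone_chain v (\<lambda>ys. c (u # ys)) xs \<noteq> 0" using Cons.prems by simp
    from Cons.IH[OF this] obtain as bs where "xs = as @ v # bs" "c (u # as @ bs) \<noteq> 0"
      by blast
    then show ?thesis by (intro exI[of _ "u # as"] exI[of _ bs]) simp
  qed
qed simp

text \<open>\<open>\<Gamma>\<close> may be any family of faces: it will be the link of
  \<open>v\<close>, but also the set of faces outside a subcomplex that avoid \<open>v\<close>,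
  which need not be down-closed.\<close>

lemma cone_chain_in_chains:
  assumes c: "c \<in> oriented_chains \<Gamma> n"
    and \<Gamma>: "\<And>\<sigma>. \<sigma> \<in> \<Gamma> \<Longrightarrow> v \<notin> \<sigma> \<and> insert v \<sigma> \<in> \<Delta>"
  shows "cone_chain v c \<in> oriented_chains \<Delta> (n + 1)"
proof (rule oriented_chainsI)
  show "alternating (cone_chain v c)"
    using oriented_chains_alternating[OF c] oriented_chains_support(2)[OF c] \<Gamma>
    by (intro alternating_cone_chain) blast+
next
  fix xs assume "cone_chain v c xs \<noteq> 0"
  then obtain as bs where xs: "xs = as @ v # bs" and nz: "c (as @ bs) \<noteq> 0"
    using cone_chain_support by metis
  from oriented_chains_support[OF c nz] \<Gamma>[of "set (as @ bs)"]
  show "distinct xs \<and> set xs \<in> \<Delta> \<and> int (length xs) = n + 1 + 1"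
    by (auto simp: xs)
qed

section \<open>Vanishing of homology\<close>

definition simplicial_complex :: "'a set set \<Rightarrow> bool" where
  "simplicial_complex \<Delta> \<longleftrightarrow> finite (\<Union>\<Delta>) \<and> (\<forall>\<sigma>\<in>\<Delta>. \<forall>\<tau>\<subseteq>\<sigma>. \<tau> \<in> \<Delta>)"

definition null_homology :: "'k::field itself \<Rightarrow> 'a set set \<Rightarrow> int \<Rightarrow> bool" where
  "null_homology _ \<Delta> n \<longleftrightarrow> (\<forall>c \<in> oriented_chains \<Delta> n.
     chain_bd \<Delta> c = (\<lambda>_. 0) \<longrightarrow> (c :: 'a list \<Rightarrow> 'k) \<in> boundaries \<Delta> n)"

lemma null_homology_iff:
  assumes "simplicial_complex \<Delta>"
  shows "null_homology TYPE('k::field) \<Delta> n \<longleftrightarrow>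
     carrier (reduced_homology \<Delta> n :: ('a list \<Rightarrow> 'k) set monoid) = {\<one>\<^bsub>reduced_homology \<Delta> n\<^esub>}"
proof -
  interpret comm_group "cycle_group \<Delta> n :: ('a list \<Rightarrow> 'k) monoid"
    by (rule comm_group_cycle_group)
  have sub: "subgroup (boundaries \<Delta> n) (cycle_group \<Delta> n :: ('a list \<Rightarrow> 'k) monoid)"
    using assms by (intro subgroup_boundaries) (auto simp: simplicial_complex_def)
  let ?B = "boundaries \<Delta> n :: ('a list \<Rightarrow> 'k) set"
  let ?C = "carrier (cycle_group \<Delta> n :: ('a list \<Rightarrow> 'k) monoid)"
  have "null_homology TYPE('k) \<Delta> n \<longleftrightarrow> ?C \<subseteq> ?B"
    by (auto simp: null_homology_def cycle_group_def)
  also have "\<dots> \<longleftrightarrow> rcosets\<^bsub>cycle_group \<Delta> n\<^esub> ?B = {?B}"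
  proof
    assume "?C \<subseteq> ?B"
    then have "?B #>\<^bsub>cycle_group \<Delta> n\<^esub> c = ?B" if "c \<in> ?C" for c
      using that by (intro coset_join2[OF that sub]) blast
    then show "rcosets\<^bsub>cycle_group \<Delta> n\<^esub> ?B = {?B}"
      using one_closed unfolding RCOSETS_def by auto
  next
    assume eq: "rcosets\<^bsub>cycle_group \<Delta> n\<^esub> ?B = {?B}"
    show "?C \<subseteq> ?B"
    proof
      fix c assume c: "c \<in> ?C"
      then have "?B #>\<^bsub>cycle_group \<Delta> n\<^esub> c = ?B"
        using eq unfolding RCOSETS_def by blast
      then show "c \<in> ?B" using rcos_self[OF c sub] by simp
    qed
  qed
  finally show ?thesis by (simp add: reduced_homology_def FactGroup_def)
qed

section \<open>Chains of a subcomplex\<close>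

lemma chain_bd_subcomplex:
  assumes "c \<in> oriented_chains \<Delta>' n" "\<Delta>' \<subseteq> \<Delta>" "finite (\<Union>\<Delta>)"
  shows "chain_bd \<Delta>' c = chain_bd \<Delta> c"
proof
  fix ys
  have "c (v # ys) = 0" if "v \<in> \<Union>\<Delta> - \<Union>\<Delta>'" for v
    using oriented_chains_support(2)[OF assms(1), of "v # ys"] that by auto
  then show "chain_bd \<Delta>' c ys = chain_bd \<Delta> c ys"
    unfolding chain_bd_def using assms by (intro sum.mono_neutral_left) auto
qed

text \<open>\<open>chain_bd\<close> sums over the vertices of its complex. On chains of
  \<open>\<Delta>'\<close> the extra vertices of \<open>\<Delta>\<close> contribute zero, so every
  boundary can be taken in \<open>\<Delta>\<close>.\<close>

lemma null_homology_subcomplex: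
  assumes "\<Delta>' \<subseteq> \<Delta>" "finite (\<Union>\<Delta>)"
  shows "null_homology TYPE('k::field) \<Delta>' n \<longleftrightarrow>
    (\<forall>c \<in> oriented_chains \<Delta>' n. chain_bd \<Delta> c = (\<lambda>_. 0 :: 'k) \<longrightarrow>
      (\<exists>d \<in> oriented_chains \<Delta>' (n + 1). c = chain_bd \<Delta> d))"
proof -
  have bd: "chain_bd \<Delta>' c = chain_bd \<Delta> c" if "c \<in> oriented_chains \<Delta>' m" for m and c :: "'a list \<Rightarrow> 'k"
    using chain_bd_subcomplex[OF that assms] .
  show ?thesis
    unfolding null_homology_def boundaries_def image_iff
    by (simp add: bd[of _ n] bd[of _ "n + 1"] cong: ball_cong bex_cong)
qed

section \<open>Boundaries of cones, and matchings that toggle one vertex\<close>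

lemma chain_bd_diff: "chain_bd \<Delta> (\<lambda>xs. c xs - d xs) = (\<lambda>ys. chain_bd \<Delta> c ys - chain_bd \<Delta> d ys)"
  by (simp add: chain_bd_def sum_subtractf)

lemma chain_bd_add: "chain_bd \<Delta> (\<lambda>xs. c xs + d xs) = (\<lambda>ys. chain_bd \<Delta> c ys + chain_bd \<Delta> d ys)"
  by (simp add: chain_bd_def sum.distrib)

lemma chain_bd_uminus: "chain_bd \<Delta> (\<lambda>xs. - c xs) = (\<lambda>ys. - chain_bd \<Delta> c ys)"
  by (simp add: chain_bd_def sum_negf)

text \<open>Taking the part of a chain at \<open>v\<close> anticommutes with the boundary: the
  summed vertex has to be swapped with \<open>v\<close>.\<close>

lemma chain_bd_Cons:
  assumes "alternating c"
  shows "chain_bd \<Delta> c (v # ys) = - chain_bd \<Delta> (\<lambda>xs. c (v # xs)) ys"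
proof -
  have "c (u # v # ys) = - c (v # u # ys)" for u
    using alternatingD[OF assms, of "[]" u v ys] by simp
  then show ?thesis by (simp only: chain_bd_def sum_negf)
qed

text \<open>Together with \<open>chain_bd_cone_Cons\<close> this is the formula
  \<open>\<partial>(v * c) = c - v * \<partial>c\<close> for chains \<open>c\<close> without
  \<open>v\<close>, read here at lists without \<open>v\<close> and there at lists headed by
  \<open>v\<close>.\<close>

lemma chain_bd_cone_notin:
  assumes "finite (\<Union>\<Delta>)" "v \<in> \<Union>\<Delta>" "v \<notin> set ys"
  shows "chain_bd \<Delta> (cone_chain v c) ys = c ys"
proof -
  have "chain_bd \<Delta> (cone_chain v c) ys = (\<Sum>u\<in>\<Union>\<Delta>. if u = v then c ys else 0)"
    unfolding chain_bd_def using assms(3) by (intro sum.cong) (auto simp: cone_chain_notin)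
  then show ?thesis using assms(1,2) by simp
qed

lemma chain_bd_cone_Cons:
  assumes "alternating c" "\<And>xs. v \<in> set xs \<Longrightarrow> c xs = 0"
  shows "chain_bd \<Delta> (cone_chain v c) (v # ys) = - chain_bd \<Delta> c ys"
  using chain_bd_Cons[OF alternating_cone_chain[OF assms]] by simp

text \<open>
  The hypotheses say that \<open>\<sigma> \<mapsto> \<sigma> \<triangle> {v}\<close> is a matching of the faces outside \<open>\<Delta>'\<close>. Coning with \<open>v\<close>
  is then a contracting homotopy of the relative chain complex.
\<close>

lemma push_into_subcomplex:
  assumes \<Delta>: "simplicial_complex \<Delta>" and \<Delta>': "simplicial_complex \<Delta>'" and sub: "\<Delta>' \<subseteq> \<Delta>"
    and ins: "\<And>\<sigma>. \<sigma> \<in> \<Delta> - \<Delta>' \<Longrightarrow> insert v \<sigma> \<in> \<Delta>"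
    and del: "\<And>\<sigma>. \<sigma> \<in> \<Delta> - \<Delta>' \<Longrightarrow> \<sigma> - {v} \<notin> \<Delta>'"
    and c: "c \<in> oriented_chains \<Delta> n"
    and bd: "chain_bd \<Delta> c \<in> oriented_chains \<Delta>' m"
  obtains k where "k \<in> oriented_chains \<Delta> (n + 1)"
    "(\<lambda>xs. c xs - chain_bd \<Delta> k xs) \<in> oriented_chains \<Delta>' n"
proof (cases "\<Delta> - \<Delta>' = {}")
  case True
  have "(\<lambda>_. 0) \<in> oriented_chains \<Delta> (n + 1)" by (simp add: oriented_chains_def)
  moreover have "(\<lambda>xs. c xs - chain_bd \<Delta> (\<lambda>_. 0) xs) \<in> oriented_chains \<Delta>' n"
    using True c sub by (auto simp: chain_bd_def dest: subset_antisym)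
  ultimately show ?thesis by (rule that)
next
  case False
  have fin: "finite (\<Union>\<Delta>)" and down: "\<And>\<sigma> \<tau>. \<sigma> \<in> \<Delta> \<Longrightarrow> \<tau> \<subseteq> \<sigma> \<Longrightarrow> \<tau> \<in> \<Delta>"
    and down': "\<And>\<sigma> \<tau>. \<sigma> \<in> \<Delta>' \<Longrightarrow> \<tau> \<subseteq> \<sigma> \<Longrightarrow> \<tau> \<in> \<Delta>'"
    using \<Delta> \<Delta>' by (auto simp: simplicial_complex_def)
  have v: "v \<in> \<Union>\<Delta>" using False ins by blast
  note alt = oriented_chains_alternating[OF c]
  \<comment> \<open>\<open>P\<close> picks the lower face of each matched pair, and \<open>r\<close>
    is the part of \<open>c\<close> on these faces. The chain \<open>k\<close> will be the cone over
    \<open>r\<close>.\<close>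
  define P where "P \<sigma> \<longleftrightarrow> \<sigma> \<in> \<Delta> - \<Delta>' \<and> v \<notin> \<sigma>" for \<sigma>
  define r where "r xs = (if P (set xs) then c xs else 0)" for xs
  have altr: "alternating r"
    unfolding r_def by (rule alternating_restrict[OF alt])
  have r_v: "r xs = 0" if "v \<in> set xs" for xs
    using that by (simp add: r_def P_def)
  have "r \<in> oriented_chains (Collect P) n"
    using altr oriented_chains_support[OF c]
    by (intro oriented_chainsI) (auto simp: r_def split: if_splits)
  then have k: "cone_chain v r \<in> oriented_chains \<Delta> (n + 1)"
    by (rule cone_chain_in_chains) (use ins in \<open>auto simp: P_def\<close>)
  let ?d = "\<lambda>xs. c xs - chain_bd \<Delta> (cone_chain v r) xs"
  have d: "?d \<in> oriented_chains \<Delta> n"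
    using c chain_bd_in_chains[OF k down] by (rule oriented_chains_diff)
  have notin: "?d xs = 0" if "set xs \<notin> \<Delta>'" "set xs \<in> \<Delta>" "v \<notin> set xs" for xs
    using that chain_bd_cone_notin[OF fin v that(3), of r] by (simp add: r_def P_def)
  \<comment> \<open>Upper faces of the pairs: since \<open>set zs\<close> is not in
    \<open>\<Delta>'\<close>, the boundary of \<open>c\<close> vanishes at \<open>zs\<close>. This
    forces \<open>c (v # zs) = - chain_bd \<Delta> r zs\<close>, which is the value of the boundary
    of the cone at \<open>v # zs\<close>.\<close>
  have hd: "?d (v # zs) = 0" if zs: "insert v (set zs) \<notin> \<Delta>'" "insert v (set zs) \<in> \<Delta>" "v \<notin> set zs" for zs
  proof -
    have zs': "set zs \<notin> \<Delta>'"
      using del[of "insert v (set zs)"] zs by simp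
    then have "0 = chain_bd \<Delta> c zs"
      using oriented_chains_support(2)[OF bd] by metis
    also have "\<dots> = c (v # zs) + (\<Sum>u\<in>\<Union>\<Delta> - {v}. c (u # zs))"
      unfolding chain_bd_def by (rule sum.remove[OF fin v])
    also have "(\<Sum>u\<in>\<Union>\<Delta> - {v}. c (u # zs)) = (\<Sum>u\<in>\<Union>\<Delta> - {v}. r (u # zs))"
    proof (rule sum.cong)
      fix u assume "u \<in> \<Union>\<Delta> - {v}"
      moreover have "set (u # zs) \<notin> \<Delta>'" using zs' down' by (metis set_subset_Cons)
      ultimately show "c (u # zs) = r (u # zs)"
        using zs(3) oriented_chains_support(2)[OF c, of "u # zs"] by (auto simp: r_def P_def)
    qed simp
    also have "\<dots> = chain_bd \<Delta> r zs"
      unfolding chain_bd_def using sum.remove[OF fin v, of "\<lambda>u. r (u # zs)"] r_v by simp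
    finally show ?thesis
      using chain_bd_cone_Cons[OF altr r_v] by (simp add: algebra_simps)
  qed
  have "?d \<in> oriented_chains \<Delta>' n"
  proof (rule oriented_chainsI)
    show "alternating ?d" by (rule oriented_chains_alternating[OF d])
  next
    fix xs assume nz: "?d xs \<noteq> 0"
    note s = oriented_chains_support[OF d nz]
    have "set xs \<in> \<Delta>'"
    proof (rule ccontr)
      assume nin: "set xs \<notin> \<Delta>'"
      then have "v \<in> set xs" using notin s nz by blast
      then obtain as bs where xs: "xs = as @ v # bs" by (meson split_list)
      have "?d (v # as @ bs) = 0"
        using s nin by (intro hd) (auto simp: xs)
      then have "?d xs = 0"
        unfolding xs by (rule alternating_zero_moved[OF oriented_chains_alternating[OF d]])
      with nz show False by simp
    qed
    with s show "distinct xs \<and> set xs \<in> \<Delta>' \<and> int (length xs) = n + 1" by simp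
  qed
  with k show ?thesis by (rule that)
qed

lemma zero_in_chains: "(\<lambda>_. 0) \<in> oriented_chains \<Delta> n"
  by (simp add: oriented_chains_def)

text \<open>By \<open>push_into_subcomplex\<close>, a chain of \<open>\<Delta>\<close> with boundary
  in \<open>\<Delta>'\<close> can be pushed into \<open>\<Delta>'\<close> modulo a boundary. Doing
  so with a bounding chain carries vanishing from \<open>\<Delta>\<close> to
  \<open>\<Delta>'\<close>, with a cycle from \<open>\<Delta>'\<close> to
  \<open>\<Delta>\<close>.\<close>

lemma null_homology_toggle:
  assumes \<Delta>: "simplicial_complex \<Delta>" and \<Delta>': "simplicial_complex \<Delta>'" and sub: "\<Delta>' \<subseteq> \<Delta>"
    and ins: "\<And>\<sigma>. \<sigma> \<in> \<Delta> - \<Delta>' \<Longrightarrow> insert v \<sigma> \<in> \<Delta>"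
    and del: "\<And>\<sigma>. \<sigma> \<in> \<Delta> - \<Delta>' \<Longrightarrow> \<sigma> - {v} \<notin> \<Delta>'"
  shows "null_homology TYPE('k::field) \<Delta> n \<longleftrightarrow> null_homology TYPE('k) \<Delta>' n"
proof -
  have fin: "finite (\<Union>\<Delta>)" and down: "\<And>\<sigma> \<tau>. \<sigma> \<in> \<Delta> \<Longrightarrow> \<tau> \<subseteq> \<sigma> \<Longrightarrow> \<tau> \<in> \<Delta>"
    using \<Delta> by (auto simp: simplicial_complex_def)
  note push = push_into_subcomplex[OF \<Delta> \<Delta>' sub ins del]
  note mono = subsetD[OF oriented_chains_mono[OF sub]]
  show ?thesis
    unfolding null_homology_subcomplex[OF sub fin] null_homology_subcomplex[OF subset_refl fin]
  proof (intro iffI ballI impI)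
    fix c :: "'a list \<Rightarrow> 'k"
    assume H: "\<forall>c\<in>oriented_chains \<Delta> n. chain_bd \<Delta> c = (\<lambda>_. 0 :: 'k) \<longrightarrow>
        (\<exists>d\<in>oriented_chains \<Delta> (n + 1). c = chain_bd \<Delta> d)"
      and c: "c \<in> oriented_chains \<Delta>' n" "chain_bd \<Delta> c = (\<lambda>_. 0)"
    from H mono[OF c(1)] c(2) obtain e where e: "e \<in> oriented_chains \<Delta> (n + 1)" "c = chain_bd \<Delta> e"
      by blast
    obtain k where k: "k \<in> oriented_chains \<Delta> (n + 1 + 1)"
      "(\<lambda>xs. e xs - chain_bd \<Delta> k xs) \<in> oriented_chains \<Delta>' (n + 1)"
      by (rule push[OF _ _ e(1), of n]) (use c(1) e(2) in auto)
    have "c = chain_bd \<Delta> (\<lambda>xs. e xs - chain_bd \<Delta> k xs)"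
      by (simp add: chain_bd_diff chain_bd_chain_bd[OF k(1)] e(2))
    with k(2) show "\<exists>d\<in>oriented_chains \<Delta>' (n + 1). c = chain_bd \<Delta> d" by blast
  next
    fix c :: "'a list \<Rightarrow> 'k"
    assume H: "\<forall>c\<in>oriented_chains \<Delta>' n. chain_bd \<Delta> c = (\<lambda>_. 0 :: 'k) \<longrightarrow>
        (\<exists>d\<in>oriented_chains \<Delta>' (n + 1). c = chain_bd \<Delta> d)"
      and c: "c \<in> oriented_chains \<Delta> n" "chain_bd \<Delta> c = (\<lambda>_. 0)"
    obtain k where k: "k \<in> oriented_chains \<Delta> (n + 1)"
      "(\<lambda>xs. c xs - chain_bd \<Delta> k xs) \<in> oriented_chains \<Delta>' n"
      by (rule push[OF _ _ c(1), of n]) (use c(2) zero_in_chains in auto)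
    have "chain_bd \<Delta> (\<lambda>xs. c xs - chain_bd \<Delta> k xs) = (\<lambda>_. 0)"
      by (simp add: chain_bd_diff chain_bd_chain_bd[OF k(1)] c(2))
    with H k(2) obtain d where d: "d \<in> oriented_chains \<Delta>' (n + 1)"
      "(\<lambda>xs. c xs - chain_bd \<Delta> k xs) = chain_bd \<Delta> d" by blast
    have "(\<lambda>xs. d xs + k xs) \<in> oriented_chains \<Delta> (n + 1)"
      using mono[OF d(1)] k(1) by (rule oriented_chains_add)
    moreover have "c = chain_bd \<Delta> (\<lambda>xs. d xs + k xs)"
      using d(2) unfolding chain_bd_add fun_eq_iff diff_eq_eq .
    ultimately show "\<exists>d\<in>oriented_chains \<Delta> (n + 1). c = chain_bd \<Delta> d" by blast
  qed
qed

text \<open>In a cone with apex \<open>v\<close>, toggling \<open>v\<close> matches all faces, the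
  empty one included. Hence the comparison is with the empty family, whose only chain is
  zero.\<close>

lemma null_homology_cone:
  assumes "simplicial_complex \<Delta>" "\<And>\<sigma>. \<sigma> \<in> \<Delta> \<Longrightarrow> insert v \<sigma> \<in> \<Delta>"
  shows "null_homology TYPE('k::field) \<Delta> n"
proof -
  have "null_homology TYPE('k) ({} :: 'a set set) n"
  proof -
    have "c = (\<lambda>_. 0)" if "c \<in> oriented_chains {} n" for c :: "'a list \<Rightarrow> 'k"
      using oriented_chains_support(2)[OF that] by auto
    moreover have "(\<lambda>_. 0 :: 'k) \<in> boundaries ({} :: 'a set set) n"
      unfolding boundaries_def
      by (rule image_eqI[OF _ zero_in_chains]) (simp add: chain_bd_def)
    ultimately show ?thesis unfolding null_homology_def by blast
  qed
  then show ?thesis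
    using null_homology_toggle[where 'k = 'k and v = v and \<Delta>' = "{}", OF assms(1)] assms(2) by (simp add: simplicial_complex_def)
qed

section \<open>Deletion and link of a vertex\<close>

definition deletion :: "'a \<Rightarrow> 'a set set \<Rightarrow> 'a set set" where
  "deletion v \<Delta> = {\<sigma> \<in> \<Delta>. v \<notin> \<sigma>}"

definition link :: "'a \<Rightarrow> 'a set set \<Rightarrow> 'a set set" where
  "link v \<Delta> = {\<sigma>. v \<notin> \<sigma> \<and> insert v \<sigma> \<in> \<Delta>}"

lemma link_part_in_chains:
  assumes "c \<in> oriented_chains \<Delta> n"
  shows "(\<lambda>xs. c (v # xs)) \<in> oriented_chains (link v \<Delta>) (n - 1)"
proof (rule oriented_chainsI)
  show "alternating (\<lambda>xs. c (v # xs))"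
    by (rule alternating_Cons[OF oriented_chains_alternating[OF assms]])
next
  fix xs assume "c (v # xs) \<noteq> 0"
  from oriented_chains_support[OF assms this]
  show "distinct xs \<and> set xs \<in> link v \<Delta> \<and> int (length xs) = n - 1 + 1"
    by (auto simp: link_def)
qed

lemma in_chains_deletion:
  assumes c: "c \<in> oriented_chains \<Delta> n" and z: "\<And>ys. c (v # ys) = 0"
  shows "c \<in> oriented_chains (deletion v \<Delta>) n"
proof (rule oriented_chainsI)
  show alt: "alternating c" by (rule oriented_chains_alternating[OF c])
  fix xs assume nz: "c xs \<noteq> 0"
  have "v \<notin> set xs"
  proof
    assume "v \<in> set xs"
    then obtain as bs where "xs = as @ v # bs" by (meson split_list)
    with alternating_zero_moved[OF alt z] nz show False by simp
  qed
  with oriented_chains_support[OF c nz]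
  show "distinct xs \<and> set xs \<in> deletion v \<Delta> \<and> int (length xs) = n + 1"
    by (simp add: deletion_def)
qed

context
  fixes \<Delta> :: "'a set set" and v :: 'a
  assumes \<Delta>: "simplicial_complex \<Delta>"
begin

lemma complex_down: "\<sigma> \<in> \<Delta> \<Longrightarrow> \<tau> \<subseteq> \<sigma> \<Longrightarrow> \<tau> \<in> \<Delta>"
  using \<Delta> by (simp add: simplicial_complex_def)

lemma complex_finite: "finite (\<Union>\<Delta>)"
  using \<Delta> by (simp add: simplicial_complex_def)

lemma deletion_subset: "deletion v \<Delta> \<subseteq> \<Delta>"
  by (auto simp: deletion_def)

lemma link_subset_deletion: "link v \<Delta> \<subseteq> deletion v \<Delta>"
  using complex_down by (auto simp: deletion_def link_def)

lemma link_subset: "link v \<Delta> \<subseteq> \<Delta>"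
  using link_subset_deletion deletion_subset by blast

text \<open>The part of a cycle \<open>c\<close> at \<open>v\<close> is, up to sign, a cycle of the
  link and bounds some \<open>f\<close> there. Adding the boundary of the cone over \<open>f\<close>
  to \<open>c\<close> leaves a homologous cycle without \<open>v\<close>, which bounds in the
  deletion.\<close>

lemma null_homology_deletion_link:
  assumes D: "null_homology TYPE('k::field) (deletion v \<Delta>) n"
    and L: "null_homology TYPE('k) (link v \<Delta>) (n - 1)"
  shows "null_homology TYPE('k) \<Delta> n"
  unfolding null_homology_subcomplex[OF subset_refl complex_finite]
proof (intro ballI impI)
  fix c :: "'a list \<Rightarrow> 'k"
  assume c: "c \<in> oriented_chains \<Delta> n" "chain_bd \<Delta> c = (\<lambda>_. 0)"
  have "chain_bd \<Delta> (\<lambda>xs. c (v # xs)) = (\<lambda>_. 0)"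
    using chain_bd_Cons[OF oriented_chains_alternating[OF c(1)], of \<Delta> v] c(2) by (simp add: fun_eq_iff)
  with L link_part_in_chains[OF c(1), of v]
  obtain f where f: "f \<in> oriented_chains (link v \<Delta>) n" "(\<lambda>xs. c (v # xs)) = chain_bd \<Delta> f"
    unfolding null_homology_subcomplex[OF link_subset complex_finite] by auto
  have k: "cone_chain v f \<in> oriented_chains \<Delta> (n + 1)"
    using f(1) by (rule cone_chain_in_chains) (simp add: link_def)
  let ?k = "\<lambda>xs. - cone_chain v f xs"
  have k': "?k \<in> oriented_chains \<Delta> (n + 1)" by (rule oriented_chains_uminus[OF k])
  let ?d = "\<lambda>xs. c xs - chain_bd \<Delta> ?k xs"
  have f_v: "f xs = 0" if "v \<in> set xs" for xs
    using oriented_chains_support(2)[OF f(1), of xs] that by (auto simp: link_def)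
  have "?d \<in> oriented_chains \<Delta> n"
    using c(1) chain_bd_in_chains[OF k' complex_down] by (rule oriented_chains_diff)
  moreover have "?d (v # ys) = 0" for ys
    using chain_bd_cone_Cons[OF oriented_chains_alternating[OF f(1)] f_v]
      fun_cong[OF f(2), of ys] by (simp add: chain_bd_uminus)
  ultimately have "?d \<in> oriented_chains (deletion v \<Delta>) n"
    by (rule in_chains_deletion)
  moreover have "chain_bd \<Delta> ?d = (\<lambda>_. 0)"
    unfolding chain_bd_diff chain_bd_chain_bd[OF k'] by (simp add: c(2))
  ultimately obtain g where g: "g \<in> oriented_chains (deletion v \<Delta>) (n + 1)" "?d = chain_bd \<Delta> g"
    using D unfolding null_homology_subcomplex[OF deletion_subset complex_finite] by blast
  have "(\<lambda>xs. g xs + ?k xs) \<in> oriented_chains \<Delta> (n + 1)"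
    using subsetD[OF oriented_chains_mono[OF deletion_subset] g(1)] k' by (rule oriented_chains_add)
  moreover have "c = chain_bd \<Delta> (\<lambda>xs. g xs + ?k xs)"
    using g(2) unfolding chain_bd_add fun_eq_iff diff_eq_eq .
  ultimately show "\<exists>d\<in>oriented_chains \<Delta> (n + 1). c = chain_bd \<Delta> d" by blast
qed

text \<open>A cycle \<open>c\<close> of the link is the boundary of some \<open>d\<close> in the
  acyclic deletion, and \<open>v * c - d\<close> is a cycle of \<open>\<Delta>\<close>, since the
  boundary of \<open>v * c\<close> is \<open>c\<close> as well. If it is the boundary of
  \<open>e\<close>, then the part of \<open>e\<close> at \<open>v\<close>, negated, fills
  \<open>c\<close> in the link.\<close>

lemma null_homology_link:
  assumes v: "v \<in> \<Union>\<Delta>" and D: "\<And>m. null_homology TYPE('k::field) (deletion v \<Delta>) m"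
  shows "null_homology TYPE('k) \<Delta> n \<longleftrightarrow> null_homology TYPE('k) (link v \<Delta>) (n - 1)"
proof
  assume H: "null_homology TYPE('k) \<Delta> n"
  show "null_homology TYPE('k) (link v \<Delta>) (n - 1)"
    unfolding null_homology_subcomplex[OF link_subset complex_finite]
  proof (intro ballI impI)
    fix c :: "'a list \<Rightarrow> 'k"
    assume c: "c \<in> oriented_chains (link v \<Delta>) (n - 1)" "chain_bd \<Delta> c = (\<lambda>_. 0)"
    have "c \<in> oriented_chains (deletion v \<Delta>) (n - 1)"
      using c(1) oriented_chains_mono[OF link_subset_deletion] by blast
    with D[of "n - 1"] c(2)
    obtain d where d: "d \<in> oriented_chains (deletion v \<Delta>) n" "c = chain_bd \<Delta> d"
      unfolding null_homology_subcomplex[OF deletion_subset complex_finite] by auto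
    have c_v: "c xs = 0" if "v \<in> set xs" for xs
      using oriented_chains_support(2)[OF c(1), of xs] that by (auto simp: link_def)
    have d_v: "d xs = 0" if "v \<in> set xs" for xs
      using oriented_chains_support(2)[OF d(1), of xs] that by (auto simp: deletion_def)
    let ?k = "\<lambda>xs. cone_chain v c xs - d xs"
    have "cone_chain v c \<in> oriented_chains \<Delta> (n - 1 + 1)"
      using c(1) by (rule cone_chain_in_chains) (simp add: link_def)
    then have k: "?k \<in> oriented_chains \<Delta> n"
      using d(1) oriented_chains_mono[OF deletion_subset] by (intro oriented_chains_diff) auto
    then have alt: "alternating (chain_bd \<Delta> ?k)"
      using chain_bd_in_chains[of ?k \<Delta> "n - 1"] complex_down
      by (intro oriented_chains_alternating[of _ \<Delta> "n - 1"]) simp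
    have "chain_bd \<Delta> d (v # ys) = 0" for ys
      by (simp add: chain_bd_def d_v)
    then have hd: "chain_bd \<Delta> ?k (v # ys) = 0" for ys
      using chain_bd_cone_Cons[OF oriented_chains_alternating[OF c(1)] c_v] c(2)
      by (simp add: chain_bd_diff)
    have "chain_bd \<Delta> ?k = (\<lambda>_. 0)"
    proof
      fix ys
      show "chain_bd \<Delta> ?k ys = 0"
      proof (cases "v \<in> set ys")
        case True
        then obtain as bs where "ys = as @ v # bs" by (meson split_list)
        with alternating_zero_moved[OF alt hd] show ?thesis by simp
      next
        case False
        then show ?thesis
          using chain_bd_cone_notin[OF complex_finite v False, of c]
          by (simp add: chain_bd_diff flip: d(2))
      qed
    qed
    with H k obtain e where e: "e \<in> oriented_chains \<Delta> (n + 1)" "?k = chain_bd \<Delta> e"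
      unfolding null_homology_subcomplex[OF subset_refl complex_finite] by blast
    let ?e = "\<lambda>xs. - e (v # xs)"
    have "?e \<in> oriented_chains (link v \<Delta>) n"
      using oriented_chains_uminus[OF link_part_in_chains[OF e(1), of v]] by simp
    moreover have "c ys = chain_bd \<Delta> ?e ys" for ys
      using fun_cong[OF e(2), of "v # ys"] chain_bd_Cons[OF oriented_chains_alternating[OF e(1)], of \<Delta> v ys]
      by (simp add: d_v chain_bd_uminus)
    ultimately show "\<exists>d\<in>oriented_chains (link v \<Delta>) (n - 1 + 1). c = chain_bd \<Delta> d"
      by auto
  qed
qed (rule null_homology_deletion_link[OF D])

end


section \<open>Relabelling vertices\<close>

lemma chain_bd_map:
  assumes "inj f"
  shows "chain_bd \<Delta> (\<lambda>xs. c (map f xs)) ys = chain_bd ((`) f ` \<Delta>) c (map f ys)"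
proof -
  have "\<Union>((`) f ` \<Delta>) = f ` \<Union>\<Delta>" by blast
  then show ?thesis
    unfolding chain_bd_def using assms by (simp add: sum.reindex inj_on_subset)
qed

lemma alternating_map: "alternating c \<Longrightarrow> alternating (\<lambda>xs. c (map f xs))"
  unfolding alternating_def map_append list.map by blast

text \<open>An involution is its own inverse, so the single fact \<open>ch\<close> carries chains in
  both directions. The transposition in \<open>null_homology_rename\<close> is of this kind.\<close>

lemma null_homology_involution:
  fixes f :: "'a \<Rightarrow> 'a"
  assumes f: "\<And>u. f (f u) = u" and N: "null_homology TYPE('k::field) \<Delta> n"
  shows "null_homology TYPE('k) ((`) f ` \<Delta>) n"
proof -
  let ?\<Delta> = "(`) f ` \<Delta>"
  have inj: "inj f" by (metis f injI)
  have ff: "f ` f ` \<sigma> = \<sigma>" for \<sigma> using f by (auto simp: image_image)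
  have mm: "map f (map f xs) = xs" for xs using f by (simp add: map_idI)
  have ch: "(\<lambda>xs. c (map f xs)) \<in> oriented_chains ((`) f ` \<Gamma>) m"
    if "c \<in> oriented_chains \<Gamma> m" for c :: "'a list \<Rightarrow> 'k" and \<Gamma> m
  proof (rule oriented_chainsI)
    fix xs assume "c (map f xs) \<noteq> 0"
    from oriented_chains_support[OF that this]
    show "distinct xs \<and> set xs \<in> (`) f ` \<Gamma> \<and> int (length xs) = m + 1"
      using ff[of "set xs"] by (auto simp: distinct_map image_iff)
  qed (rule alternating_map[OF oriented_chains_alternating[OF that]])
  have invol: "(`) f ` ?\<Delta> = \<Delta>" by (simp add: image_image f)
  show ?thesis
    unfolding null_homology_def
  proof (intro ballI impI)
    fix c :: "'a list \<Rightarrow> 'k"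
    assume c: "c \<in> oriented_chains ?\<Delta> n" "chain_bd ?\<Delta> c = (\<lambda>_. 0)"
    let ?c = "\<lambda>xs. c (map f xs)"
    have "?c \<in> oriented_chains \<Delta> n" using ch[OF c(1)] by (simp only: invol)
    moreover have "chain_bd \<Delta> ?c = (\<lambda>_. 0)"
      using chain_bd_map[OF inj, of \<Delta> c] c(2) by (simp add: fun_eq_iff)
    ultimately obtain d where d: "d \<in> oriented_chains \<Delta> (n + 1)" "?c = chain_bd \<Delta> d"
      using N unfolding null_homology_def boundaries_def by blast
    have "c = chain_bd ?\<Delta> (\<lambda>xs. d (map f xs))"
    proof
      fix ys
      have "c ys = chain_bd \<Delta> d (map f ys)"
        using fun_cong[OF d(2), of "map f ys"] by (simp only: mm)
      also have "\<dots> = chain_bd ?\<Delta> (\<lambda>xs. d (map f xs)) ys"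
        unfolding chain_bd_map[OF inj] invol ..
      finally show "c ys = chain_bd ?\<Delta> (\<lambda>xs. d (map f xs)) ys" .
    qed
    with ch[OF d(1)] show "c \<in> boundaries ?\<Delta> n" unfolding boundaries_def by blast
  qed
qed

section \<open>Independence complexes\<close>

lemma simplicial_complex_independence_complex:
  "finite S \<Longrightarrow> simplicial_complex (independence_complex S E)"
  unfolding simplicial_complex_def
  by (auto simp: independence_complex_def intro: finite_subset[of _ S])

lemma induced_subcomplex_independence_complex:
  "S \<subseteq> V \<Longrightarrow> induced_subcomplex (independence_complex V E) S = independence_complex S E"
  by (auto simp: induced_subcomplex_def independence_complex_def)

lemma independence_complex_cong:
  assumes "\<And>u w. u \<in> S \<Longrightarrow> w \<in> S \<Longrightarrow> {u, w} \<in> E \<longleftrightarrow> {u, w} \<in> E'"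
  shows "independence_complex S E = independence_complex S E'"
  using assms unfolding independence_complex_def by blast

lemma deletion_independence_complex:
  "deletion v (independence_complex S E) = independence_complex (S - {v}) E"
  by (auto simp: deletion_def independence_complex_def)

text \<open>Independence also quantifies over equal vertices, where the pair is \<open>{v}\<close>;
  thus \<open>{v} \<notin> E\<close> says that \<open>v\<close> alone is a face.\<close>

lemma link_independence_complex:
  assumes "v \<in> S" "{v} \<notin> E"
  shows "link v (independence_complex S E) = independence_complex (S - {v} - neighbourhood E v) E"
proof (rule Set.set_eqI)
  fix \<sigma>
  have "(\<forall>u\<in>insert v \<sigma>. \<forall>w\<in>insert v \<sigma>. {u, w} \<notin> E) \<longleftrightarrow>
      (\<forall>w\<in>\<sigma>. {v, w} \<notin> E) \<and> (\<forall>u\<in>\<sigma>. \<forall>w\<in>\<sigma>. {u, w} \<notin> E)"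
    using assms(2) by (simp add: insert_commute[of _ v]) blast
  then show "\<sigma> \<in> link v (independence_complex S E) \<longleftrightarrow>
      \<sigma> \<in> independence_complex (S - {v} - neighbourhood E v) E"
    using assms(1) unfolding link_def independence_complex_def neighbourhood_def by blast
qed

lemma insert_independence_complex:
  assumes "\<sigma> \<in> independence_complex S E" "v \<in> S" "{v} \<notin> E" "\<And>u. u \<in> \<sigma> \<Longrightarrow> {v, u} \<notin> E"
  shows "insert v \<sigma> \<in> independence_complex S E"
  using assms by (auto simp: independence_complex_def insert_commute[of _ v])

lemma null_homology_isolated:
  assumes "finite S" "v \<in> S" "\<And>u. u \<in> S \<Longrightarrow> {v, u} \<notin> E"
  shows "null_homology TYPE('k::field) (independence_complex S E) n"
proof (rule null_homology_cone[OF simplicial_complex_independence_complex[OF assms(1)]])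
  fix \<sigma> assume "\<sigma> \<in> independence_complex S E"
  then show "insert v \<sigma> \<in> independence_complex S E"
    using assms(2,3) assms(3)[OF assms(2)] by (auto simp: independence_complex_def insert_commute)
qed

lemma null_homology_remove_vertex:
  assumes "finite S" "v \<in> S" "{v} \<notin> E"
    and "null_homology TYPE('k::field) (independence_complex (S - {v}) E) n"
    and "null_homology TYPE('k) (independence_complex (S - {v} - neighbourhood E v) E) (n - 1)"
  shows "null_homology TYPE('k) (independence_complex S E) n"
  using assms(4,5)
  unfolding link_independence_complex[OF assms(2,3), symmetric]
    deletion_independence_complex[symmetric]
  by (rule null_homology_deletion_link[OF simplicial_complex_independence_complex[OF assms(1)]])

text \<open>Without \<open>y\<close> the leaf \<open>a\<close> is isolated, so the deletion of
  \<open>y\<close> is a cone with apex \<open>a\<close>, and the homology is that of the link of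
  \<open>y\<close> shifted by one.\<close>

lemma null_homology_leaf:
  assumes "finite S" "a \<in> S" "y \<in> S" "{y} \<notin> E" "a \<noteq> y"
    and leaf: "\<And>u. u \<in> S \<Longrightarrow> {a, u} \<in> E \<longleftrightarrow> u = y"
  shows "null_homology TYPE('k::field) (independence_complex S E) n \<longleftrightarrow>
    null_homology TYPE('k) (independence_complex (S - {y} - neighbourhood E y) E) (n - 1)"
proof -
  have y: "y \<in> \<Union>(independence_complex S E)"
    using assms(3,4) by (auto simp: independence_complex_def intro!: exI[of _ "{y}"])
  have acyclic: "null_homology TYPE('k) (deletion y (independence_complex S E)) m" for m
    unfolding deletion_independence_complex
    using assms by (intro null_homology_isolated[of _ a]) auto
  show ?thesis
    using null_homology_link[OF simplicial_complex_independence_complex[OF assms(1)] y acyclic]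
      assms(3,4) by (simp add: link_independence_complex)
qed

lemma transpose_image_independence_complex:
  assumes "p \<notin> S" "q \<notin> S" "{q} \<notin> E'"
    and "\<And>u w. u \<in> S \<Longrightarrow> w \<in> S \<Longrightarrow> {u, w} \<in> E \<longleftrightarrow> {u, w} \<in> E'"
    and "\<And>u. u \<in> S \<Longrightarrow> {p, u} \<in> E \<longleftrightarrow> {q, u} \<in> E'"
    and \<sigma>: "\<sigma> \<in> independence_complex (insert p S) E"
  shows "transpose p q ` \<sigma> \<in> independence_complex (insert q S) E'"
proof -
  have sub: "\<sigma> \<subseteq> insert p S" and ind: "\<And>u w. u \<in> \<sigma> \<Longrightarrow> w \<in> \<sigma> \<Longrightarrow> {u, w} \<notin> E"
    using \<sigma> by (auto simp: independence_complex_def)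
  have t: "transpose p q p = q" "\<And>u. u \<in> S \<Longrightarrow> transpose p q u = u"
    using assms(1,2) by (auto simp: transpose_def)
  have "{transpose p q u, transpose p q w} \<notin> E'" if "u \<in> \<sigma>" "w \<in> \<sigma>" for u w
  proof -
    have "u = p \<or> u \<in> S" "w = p \<or> w \<in> S" using sub that by auto
    then show ?thesis
      using ind[OF that] ind[OF that(2,1)] assms(3-5) t by (auto simp: insert_commute[of _ q])
  qed
  moreover have "transpose p q ` \<sigma> \<subseteq> insert q S"
    using sub t by auto
  ultimately show ?thesis by (auto simp: independence_complex_def)
qed

lemma null_homology_rename:
  assumes "p \<notin> S" "q \<notin> S" "{p} \<notin> E" "{q} \<notin> E'"
    and "\<And>u w. u \<in> S \<Longrightarrow> w \<in> S \<Longrightarrow> {u, w} \<in> E \<longleftrightarrow> {u, w} \<in> E'"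
    and "\<And>u. u \<in> S \<Longrightarrow> {p, u} \<in> E \<longleftrightarrow> {q, u} \<in> E'"
  shows "null_homology TYPE('k::field) (independence_complex (insert p S) E) n \<longleftrightarrow>
    null_homology TYPE('k) (independence_complex (insert q S) E') n"
proof -
  let ?f = "transpose p q"
  let ?P = "independence_complex (insert p S) E" and ?Q = "independence_complex (insert q S) E'"
  have "?f ` \<sigma> \<in> ?Q" if "\<sigma> \<in> ?P" for \<sigma>
    using assms that by (intro transpose_image_independence_complex[of p S q E' E \<sigma>]) auto
  moreover have "?f ` \<sigma> \<in> ?P" if "\<sigma> \<in> ?Q" for \<sigma>
    using assms that transpose_image_independence_complex[of q S p E E' \<sigma>]
    by (auto simp: transpose_commute[of q p])
  moreover have ff: "?f ` ?f ` \<sigma> = \<sigma>" for \<sigma> by (simp add: image_image)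
  ultimately have "(`) ?f ` ?P = ?Q" "(`) ?f ` ?Q = ?P"
    by (auto simp: image_iff) (metis ff)+
  then show ?thesis
    using null_homology_involution[of ?f, where 'k = 'k] by (metis transpose_involutory)
qed

section \<open>Regularity\<close>

definition nonzero_degrees :: "'k::field itself \<Rightarrow> 'a set \<Rightarrow> 'a set set \<Rightarrow> nat set" where
  "nonzero_degrees k V E =
     {j. \<exists>S\<subseteq>V. \<not> null_homology k (independence_complex S E) (int j - 1)}"

lemma nonzero_degreesI:
  "S \<subseteq> V \<Longrightarrow> \<not> null_homology k (independence_complex S E) (int j - 1) \<Longrightarrow> j \<in> nonzero_degrees k V E"
  unfolding nonzero_degrees_def by blast

lemma graph_reg_eq_Max:
  assumes "finite V"
  shows "graph_reg TYPE('k::field) V E = Max (nonzero_degrees TYPE('k) V E)"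
proof -
  have "carrier (reduced_homology (induced_subcomplex (independence_complex V E) S) m ::
          ('a list \<Rightarrow> 'k) set monoid)
        = {\<one>\<^bsub>reduced_homology (induced_subcomplex (independence_complex V E) S) m\<^esub>}
      \<longleftrightarrow> null_homology TYPE('k) (independence_complex S E) m" if "S \<subseteq> V" for S m
    unfolding induced_subcomplex_independence_complex[OF that]
    by (rule null_homology_iff[symmetric])
      (rule simplicial_complex_independence_complex[OF finite_subset[OF that assms]])
  then show ?thesis
    unfolding graph_reg_def complex_reg_def nonzero_degrees_def
    by (simp cong: conj_cong)
qed

lemma finite_nonzero_degrees:
  assumes "finite V"
  shows "finite (nonzero_degrees TYPE('k::field) V E)"
proof (rule finite_subset)
  show "nonzero_degrees TYPE('k) V E \<subseteq> {..card V}"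
  proof
    fix j assume "j \<in> nonzero_degrees TYPE('k) V E"
    then obtain S where S: "S \<subseteq> V" "\<not> null_homology TYPE('k) (independence_complex S E) (int j - 1)"
      by (auto simp: nonzero_degrees_def)
    let ?\<Delta> = "independence_complex S E"
    obtain c :: "'a list \<Rightarrow> 'k" where c: "c \<in> oriented_chains ?\<Delta> (int j - 1)"
      "c \<notin> boundaries ?\<Delta> (int j - 1)"
      using S(2) unfolding null_homology_def by blast
    have "(\<lambda>_. 0 :: 'k) \<in> boundaries ?\<Delta> (int j - 1)"
      unfolding boundaries_def
      by (rule image_eqI[OF _ zero_in_chains]) (simp add: chain_bd_def)
    with c(2) obtain xs where "c xs \<noteq> 0" by (metis ext)
    from oriented_chains_support[OF c(1) this] S(1)
    have "distinct xs" "set xs \<subseteq> V" "length xs = j"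
      by (auto simp: independence_complex_def)
    then show "j \<in> {..card V}"
      using card_mono[OF assms, of "set xs"] by (simp add: distinct_card)
  qed
qed simp

text \<open>The empty subgraph has the complex \<open>{{}}\<close>, where the empty list carries a
  cycle of degree -1 that bounds nothing. So the regularity is the maximum of a nonempty
  set.\<close>

lemma zero_in_nonzero_degrees: "0 \<in> nonzero_degrees TYPE('k::field) V E"
proof -
  let ?\<Delta> = "independence_complex {} E" and ?c = "\<lambda>xs. if xs = [] then 1 else 0 :: 'k"
  have \<Delta>: "?\<Delta> = {{}}" by (auto simp: independence_complex_def)
  have "?c \<in> oriented_chains ?\<Delta> (-1)"
    unfolding \<Delta> by (rule oriented_chainsI) (auto simp: alternating_def split: if_splits)
  moreover have "chain_bd ?\<Delta> ?c = (\<lambda>_. 0)" by (simp add: chain_bd_def)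
  moreover have "?c \<notin> boundaries ?\<Delta> (-1)"
  proof
    assume "?c \<in> boundaries ?\<Delta> (-1)"
    then obtain d where "?c = chain_bd ?\<Delta> d" unfolding boundaries_def by blast
    from fun_cong[OF this, of "[]"] show False by (simp add: \<Delta> chain_bd_def)
  qed
  ultimately have "\<not> null_homology TYPE('k) ?\<Delta> (-1)"
    unfolding null_homology_def by metis
  then show ?thesis unfolding nonzero_degrees_def by (auto intro!: exI[of _ "{}"])
qed

section \<open>The Lozin transform\<close>

locale lozin =
  fixes V :: "'a set" and E :: "'a set set" and x y a b z :: 'a and Y Z :: "'a set"
  assumes graph: "simple_graph V E"
    and x: "x \<in> V"
    and nbhd: "Y \<union> Z = neighbourhood E x"
    and disj: "Y \<inter> Z = {}"
    and dist: "distinct [y, a, b, z]"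
    and new: "{y, a, b, z} \<inter> V = {}"
begin

abbreviation EL :: "'a set set" where "EL \<equiv> lozin_edges E x Y Z y a b z"

abbreviation EY :: "'a set set" where "EY \<equiv> lozin_edges E x (Y \<union> Z) {} y a b z"

text \<open>Every fact about \<open>EL\<close> in this locale thereby becomes available for
  \<open>EY\<close>.\<close>

lemma lozin_merged: "lozin V E x y a b z (Y \<union> Z) {}"
  using graph x nbhd disj dist new by unfold_locales auto

text \<open>Reading the path backwards exchanges \<open>y\<close> with \<open>z\<close>,
  \<open>a\<close> with \<open>b\<close> and \<open>Y\<close> with \<open>Z\<close>, which shortens
  the case distinctions below. By \<open>lozin_edges_mirror\<close> the edge set stays the
  same.\<close>

lemma lozin_mirror: "lozin V E x z b a y Z Y"
  using graph x nbhd disj dist new by unfold_locales auto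

lemma lozin_edges_mirror: "lozin_edges E x Z Y z b a y = EL"
  by (auto simp: lozin_edges_def insert_commute)

lemma finite_V: "finite V"
  using graph by (simp add: simple_graph_def)

lemma edge: "{u, w} \<in> E \<Longrightarrow> u \<in> V \<and> w \<in> V \<and> u \<noteq> w"
  using graph by (auto simp: simple_graph_def)

lemma no_loop: "{u} \<notin> E"
  using edge[of u u] by auto

lemma adj_x: "{x, u} \<in> E \<longleftrightarrow> u \<in> Y \<or> u \<in> Z"
  using nbhd by (auto simp: neighbourhood_def)

lemma parts: "Y \<subseteq> V - {x}" "Z \<subseteq> V - {x}"
  using edge[of x] adj_x by blast+

lemma notin_V: "y \<notin> V" "a \<notin> V" "b \<notin> V" "z \<notin> V"
  using new by auto

lemma neq: "y \<noteq> a" "y \<noteq> b" "y \<noteq> z" "a \<noteq> b" "a \<noteq> z" "b \<noteq> z"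
  "a \<noteq> y" "b \<noteq> y" "z \<noteq> y" "b \<noteq> a" "z \<noteq> a" "z \<noteq> b"
  using dist by auto

lemma adj_y: "{y, u} \<in> EL \<longleftrightarrow> u = a \<or> u \<in> Y"
  and adj_a: "{a, u} \<in> EL \<longleftrightarrow> u = y \<or> u = b"
  and adj_b: "{b, u} \<in> EL \<longleftrightarrow> u = a \<or> u = z"
  and adj_z: "{z, u} \<in> EL \<longleftrightarrow> u = b \<or> u \<in> Z"
  and adj_old: "u \<in> V \<Longrightarrow> w \<in> V \<Longrightarrow> u \<noteq> x \<Longrightarrow> w \<noteq> x \<Longrightarrow> {u, w} \<in> EL \<longleftrightarrow> {u, w} \<in> E"
  using neq notin_V parts edge[of y u] edge[of a u] edge[of b u] edge[of z u]
  by (auto simp: lozin_edges_def doubleton_eq_iff)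

lemma no_loop_EL: "{y} \<notin> EL" "{a} \<notin> EL" "{b} \<notin> EL" "{z} \<notin> EL"
  using adj_y[of y] adj_a[of a] adj_b[of b] adj_z[of z] neq notin_V parts by auto

lemma neighbourhood_EL:
  "neighbourhood EL y = insert a Y" "neighbourhood EL a = {y, b}"
  "neighbourhood EL b = {a, z}" "neighbourhood EL z = insert b Z"
  by (auto simp: neighbourhood_def adj_y adj_a adj_b adj_z)

lemma independence_complex_old:
  "S \<subseteq> V - {x} \<Longrightarrow> independence_complex S EL = independence_complex S E"
  by (rule independence_complex_cong) (rule adj_old; blast)

text \<open>The neighbours of \<open>z\<close> in \<open>S\<close> are those in \<open>Z\<close>. As
  \<open>S\<close> misses \<open>Y\<close>, they are also the neighbours of \<open>x\<close> in
  \<open>S\<close>.\<close>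

lemma rename_z:
  assumes "S \<subseteq> V - {x}" "S \<inter> Y = {}"
  shows "null_homology TYPE('k::field) (independence_complex (insert z S) EL) n \<longleftrightarrow>
    null_homology TYPE('k) (independence_complex (insert x S) E) n"
proof (rule null_homology_rename)
  show "{u, w} \<in> EL \<longleftrightarrow> {u, w} \<in> E" if "u \<in> S" "w \<in> S" for u w
    using assms that by (intro adj_old) auto
  show "{z, u} \<in> EL \<longleftrightarrow> {x, u} \<in> E" if "u \<in> S" for u
    using assms that notin_V by (auto simp: adj_z adj_x)
qed (use assms notin_V no_loop no_loop_EL in auto)

section \<open>Moving all neighbours to one end of the path\<close>

lemma new_edge_merged:
  assumes "{u, w} \<in> EY" "{u, w} \<notin> EL"
  shows "u = y \<and> w \<in> Z \<or> w = y \<and> u \<in> Z"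
proof -
  have "EY \<subseteq> EL \<union> {{y, v} | v. v \<in> Z}" unfolding lozin_edges_def by blast
  then obtain v where "v \<in> Z" "{u, w} = {y, v}" using assms by blast
  then show ?thesis by (auto simp: doubleton_eq_iff)
qed

lemma lost_edge_merged:
  assumes "{u, w} \<in> EL" "{u, w} \<notin> EY"
  shows "u = z \<and> w \<in> Z \<or> w = z \<and> u \<in> Z"
proof -
  have "EL \<subseteq> EY \<union> {{z, v} | v. v \<in> Z}" unfolding lozin_edges_def by blast
  then obtain v where "v \<in> Z" "{u, w} = {z, v}" using assms by blast
  then show ?thesis by (auto simp: doubleton_eq_iff)
qed

text \<open>
  Moving the neighbours of \<open>z\<close> to \<open>y\<close>. An independent set containing \<open>y\<close> and a vertex of \<open>Z\<close> avoids
  \<open>a\<close> and \<open>z\<close>, so that \<open>b\<close> can be toggled; hence the edges between \<open>y\<close> and \<open>Z\<close> may be added. After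
  that, an independent set containing \<open>z\<close> and a vertex of \<open>Z\<close> avoids \<open>y\<close> and \<open>b\<close>, so that \<open>a\<close> can be
  toggled; hence the edges between \<open>z\<close> and \<open>Z\<close> may be deleted.
\<close>

lemma null_homology_merge:
  assumes "S \<subseteq> V - {x}"
  defines "T \<equiv> S \<union> {y, a, b, z}"
  shows "null_homology TYPE('k::field) (independence_complex T EL) n \<longleftrightarrow>
    null_homology TYPE('k) (independence_complex T EY) n"
proof -
  interpret M: lozin V E x y a b z "Y \<union> Z" "{}" by (rule lozin_merged)
  let ?C = "independence_complex T (EL \<union> EY)"
  have fin: "finite T" using finite_subset[OF assms(1)] finite_V by (simp add: T_def)
  note simplicial = simplicial_complex_independence_complex[OF fin]
  have "null_homology TYPE('k) (independence_complex T EL) n \<longleftrightarrow> null_homology TYPE('k) ?C n"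
  proof (rule null_homology_toggle[OF simplicial simplicial, where v = b])
    fix \<sigma> assume \<sigma>: "\<sigma> \<in> independence_complex T EL - ?C"
    then obtain u w where "u \<in> \<sigma>" "w \<in> \<sigma>" "{u, w} \<in> EY" "{u, w} \<notin> EL"
      unfolding independence_complex_def by blast
    with new_edge_merged[of u w] obtain w where w: "y \<in> \<sigma>" "w \<in> \<sigma>" "w \<in> Z"
      by blast
    have ind: "{u, v} \<notin> EL" if "u \<in> \<sigma>" "v \<in> \<sigma>" for u v
      using \<sigma> that unfolding independence_complex_def by blast
    have "a \<notin> \<sigma>" "z \<notin> \<sigma>"
      using ind[of y a] ind[of z w] w by (auto simp: adj_y adj_z)
    then show "insert b \<sigma> \<in> independence_complex T EL"
      using \<sigma> no_loop_EL by (intro insert_independence_complex) (auto simp: adj_b T_def)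
    have "{y, w} \<in> EL \<union> EY" "y \<in> \<sigma> - {b}" "w \<in> \<sigma> - {b}"
      using w notin_V parts neq by (auto simp: M.adj_y)
    then show "\<sigma> - {b} \<notin> ?C" unfolding independence_complex_def by blast
  qed (unfold independence_complex_def, blast)
  moreover have "null_homology TYPE('k) (independence_complex T EY) n \<longleftrightarrow> null_homology TYPE('k) ?C n"
  proof (rule null_homology_toggle[OF simplicial simplicial, where v = a])
    fix \<sigma> assume \<sigma>: "\<sigma> \<in> independence_complex T EY - ?C"
    then obtain u w where "u \<in> \<sigma>" "w \<in> \<sigma>" "{u, w} \<in> EL" "{u, w} \<notin> EY"
      unfolding independence_complex_def by blast
    with lost_edge_merged[of u w] obtain w where w: "z \<in> \<sigma>" "w \<in> \<sigma>" "w \<in> Z"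
      by blast
    have ind: "{u, v} \<notin> EY" if "u \<in> \<sigma>" "v \<in> \<sigma>" for u v
      using \<sigma> that unfolding independence_complex_def by blast
    have "y \<notin> \<sigma>" "b \<notin> \<sigma>"
      using ind[of y w] ind[of z b] w by (auto simp: M.adj_y M.adj_z)
    then show "insert a \<sigma> \<in> independence_complex T EY"
      using \<sigma> M.no_loop_EL by (intro insert_independence_complex) (auto simp: M.adj_a T_def)
    have "{z, w} \<in> EL \<union> EY" "z \<in> \<sigma> - {a}" "w \<in> \<sigma> - {a}"
      using w notin_V parts neq by (auto simp: adj_z)
    then show "\<sigma> - {a} \<notin> ?C" unfolding independence_complex_def by blast
  qed (unfold independence_complex_def, blast)
  ultimately show ?thesis by simp
qed

lemma null_homology_lozin:
  assumes "S \<subseteq> V - {x}"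
  shows "null_homology TYPE('k::field) (independence_complex (S \<union> {y, a, b, z}) EL) n \<longleftrightarrow>
    null_homology TYPE('k) (independence_complex (insert x S) E) (n - 1)"
proof -
  interpret M: lozin V E x y a b z "Y \<union> Z" "{}" by (rule lozin_merged)
  \<comment> \<open>Reversing the merged path puts \<open>y\<close>, which carries
    \<open>Y \<union> Z\<close>, in the place of \<open>z\<close>. The set to be avoided is then
    empty, so \<open>W.rename_z\<close> applies to every \<open>S\<close>.\<close>
  interpret W: lozin V E x z b a y "{}" "Y \<union> Z" by (rule M.lozin_mirror)
  let ?T = "S \<union> {y, a, b, z}"
  have fin: "finite ?T" using finite_subset[OF assms(1)] finite_V by simp
  have T: "?T - {b} - neighbourhood EY b = insert y S"
    using assms notin_V neq by (auto simp: M.neighbourhood_EL)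
  have "null_homology TYPE('k) (independence_complex ?T EY) n \<longleftrightarrow>
      null_homology TYPE('k) (independence_complex (?T - {b} - neighbourhood EY b) EY) (n - 1)"
    using fin M.no_loop_EL neq by (intro null_homology_leaf[of _ z]) (auto simp: M.adj_z)
  also have "\<dots> \<longleftrightarrow> null_homology TYPE('k) (independence_complex (insert x S) E) (n - 1)"
    unfolding T using W.rename_z[OF assms, where 'k = 'k] M.lozin_edges_mirror by simp
  finally show ?thesis using null_homology_merge[OF assms, where 'k = 'k] by simp
qed

section \<open>Induced subgraphs of the transform\<close>

lemma null_homology_edge:
  assumes "S \<subseteq> V - {x}" "y \<notin> P" "P \<subseteq> {y, z}"
  shows "null_homology TYPE('k::field) (independence_complex (S \<union> {a, b} \<union> P) EL) n \<longleftrightarrow>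
    null_homology TYPE('k) (independence_complex S E) (n - 1)"
proof -
  let ?T = "S \<union> {a, b} \<union> P"
  have fin: "finite ?T" using finite_subset[OF assms(1)] finite_V finite_subset[OF assms(3)] by simp
  \<comment> \<open>As \<open>y\<close> is missing, \<open>a\<close> is a leaf at \<open>b\<close>.
    The link of \<open>b\<close> also drops \<open>z\<close> and leaves \<open>S\<close>.\<close>
  have "null_homology TYPE('k) (independence_complex ?T EL) n \<longleftrightarrow>
      null_homology TYPE('k) (independence_complex (?T - {b} - neighbourhood EL b) EL) (n - 1)"
    using fin no_loop_EL neq assms notin_V by (intro null_homology_leaf[of _ a]) (auto simp: adj_a)
  also have "?T - {b} - neighbourhood EL b = S"
    using assms notin_V neq by (auto simp: neighbourhood_EL)
  finally show ?thesis by (simp add: independence_complex_old[OF assms(1)])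
qed

text \<open>As \<open>b\<close> is missing, \<open>a\<close> is a leaf at \<open>y\<close>. The link
  of \<open>y\<close> is induced on \<open>S - Y\<close> and possibly \<open>z\<close>; there
  \<open>z\<close> plays the role of \<open>x\<close>, so an induced subgraph of the original graph
  results in either case.\<close>

lemma null_homology_pendant:
  assumes "S \<subseteq> V - {x}" "P \<subseteq> {z}"
    and old: "\<And>T. T \<subseteq> V \<Longrightarrow> null_homology TYPE('k::field) (independence_complex T E) (n - 1)"
  shows "null_homology TYPE('k) (independence_complex (S \<union> {y, a} \<union> P) EL) n"
proof -
  let ?T = "S \<union> {y, a} \<union> P"
  have fin: "finite ?T" using finite_subset[OF assms(1)] finite_V finite_subset[OF assms(2)] by simp
  have "null_homology TYPE('k) (independence_complex ?T EL) n \<longleftrightarrow>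
      null_homology TYPE('k) (independence_complex (?T - {y} - neighbourhood EL y) EL) (n - 1)"
    using fin no_loop_EL neq assms(1,2) notin_V by (intro null_homology_leaf[of _ a]) (auto simp: adj_a)
  also have "?T - {y} - neighbourhood EL y = (S - Y) \<union> P"
    using assms(1,2) notin_V neq parts by (auto simp: neighbourhood_EL)
  also have "null_homology TYPE('k) (independence_complex ((S - Y) \<union> P) EL) (n - 1)"
  proof -
    have sub: "S - Y \<subseteq> V - {x}" "(S - Y) \<inter> Y = {}" using assms(1) by blast+
    show ?thesis
    proof (cases "P = {}")
      case True
      have "null_homology TYPE('k) (independence_complex (S - Y) E) (n - 1)"
        using assms(1) by (intro old) auto
      with True show ?thesis by (simp add: independence_complex_old[OF sub(1)])
    next
      case False
      have "null_homology TYPE('k) (independence_complex (insert x (S - Y)) E) (n - 1)"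
        using assms(1) x by (intro old) auto
      moreover have "(S - Y) \<union> P = insert z (S - Y)" using False assms(2) by auto
      ultimately show ?thesis by (simp add: rename_z[OF sub])
    qed
  qed
  finally show ?thesis by simp
qed

text \<open>The vertices of \<open>P\<close> are removed one at a time by
  \<open>null_homology_remove_vertex\<close>. The deletion keeps the degree and the link lowers it
  by one, which is why vanishing is assumed in the degrees \<open>n\<close> and
  \<open>n - 1\<close>.\<close>

lemma null_homology_without_path:
  assumes S: "S \<subseteq> V - {x}" and P: "P \<subseteq> {y, z}"
    and old: "\<And>T. T \<subseteq> V \<Longrightarrow> null_homology TYPE('k::field) (independence_complex T E) n"
      "\<And>T. T \<subseteq> V \<Longrightarrow> null_homology TYPE('k) (independence_complex T E) (n - 1)"
  shows "null_homology TYPE('k) (independence_complex (S \<union> P) EL) n"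
proof -
  interpret W: lozin V E x z b a y Z Y by (rule lozin_mirror)
  have fin: "finite S" using finite_subset[OF S] finite_V by simp
  have old': "null_homology TYPE('k) (independence_complex T EL) n"
    "null_homology TYPE('k) (independence_complex T EL) (n - 1)" if "T \<subseteq> S" for T
  proof -
    have "T \<subseteq> V - {x}" "T \<subseteq> V" using that S by blast+
    then show "null_homology TYPE('k) (independence_complex T EL) n"
      "null_homology TYPE('k) (independence_complex T EL) (n - 1)"
      using old by (simp_all add: independence_complex_old)
  qed
  have single: "null_homology TYPE('k) (independence_complex (insert y S) EL) n"
  proof (rule null_homology_remove_vertex[of _ y])
    have "insert y S - {y} = S" "insert y S - {y} - neighbourhood EL y \<subseteq> S"
      using S notin_V by auto
    then show "null_homology TYPE('k) (independence_complex (insert y S - {y}) EL) n"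
      "null_homology TYPE('k) (independence_complex (insert y S - {y} - neighbourhood EL y) EL) (n - 1)"
      using old' by auto
  qed (use fin no_loop_EL in auto)
  show ?thesis
  proof (cases "z \<in> P")
    case False
    then consider "S \<union> P = S" | "S \<union> P = insert y S" using P by blast
    then show ?thesis using single old'(1)[OF subset_refl] by cases simp_all
  next
    case True
    have notin_S: "y \<notin> S" "b \<notin> S" "z \<notin> S" and notin_Z: "y \<notin> Z"
      using S notin_V parts by blast+
    define Q where "Q = P - {z}"
    have notin_Q: "b \<notin> Q" "Q \<inter> Z = {}" using P neq notin_Z by (auto simp: Q_def)
    consider "Q = {}" | "Q = {y}" using P by (auto simp: Q_def)
    \<comment> \<open>These are the deletion and the link of \<open>z\<close>. If \<open>y\<close>
      remains, it has the same neighbours in \<open>S - Z\<close> as \<open>x\<close>, so in the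
      link it can be renamed to \<open>x\<close>.\<close>
    then have Q: "null_homology TYPE('k) (independence_complex (S \<union> Q) EL) n \<and>
      null_homology TYPE('k) (independence_complex ((S - Z) \<union> Q) EL) (n - 1)"
    proof cases
      case 1
      then show ?thesis using old'(1)[OF subset_refl] old'(2)[OF Diff_subset] by simp
    next
      case 2
      have "S - Z \<subseteq> V - {x}" "(S - Z) \<inter> Z = {}" "insert x (S - Z) \<subseteq> V" using S x by blast+
      then show ?thesis
        using 2 single W.rename_z[of "S - Z", where 'k = 'k] old(2)
        by (simp add: lozin_edges_mirror)
    qed
    show ?thesis
    proof (rule null_homology_remove_vertex[of _ z])
      have SP: "S \<union> P - {z} = S \<union> Q" using notin_S by (auto simp: Q_def)
      show "null_homology TYPE('k) (independence_complex (S \<union> P - {z}) EL) n"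
        unfolding SP using Q by simp
      have "S \<union> Q - insert b Z = (S - Z) \<union> Q" using notin_S notin_Q by blast
      then show "null_homology TYPE('k)
          (independence_complex (S \<union> P - {z} - neighbourhood EL z) EL) (n - 1)"
        unfolding SP neighbourhood_EL using Q by simp
      show "finite (S \<union> P)" using fin finite_subset[OF P] by simp
    qed (use True no_loop_EL in simp_all)
  qed
qed

text \<open>The cases are the possible traces of \<open>T\<close> on \<open>{a, b}\<close>. With
  both vertices, either the whole path is present or one of its ends is missing. With exactly one,
  that vertex is a leaf at its outer neighbour or isolated. With none, only \<open>y\<close> and
  \<open>z\<close> can remain.\<close>

lemma null_homology_upper:
  assumes T: "T \<subseteq> lozin_verts V x y a b z"
    and old: "\<And>T. T \<subseteq> V \<Longrightarrow> null_homology TYPE('k::field) (independence_complex T E) n"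
      "\<And>T. T \<subseteq> V \<Longrightarrow> null_homology TYPE('k) (independence_complex T E) (n - 1)"
  shows "null_homology TYPE('k) (independence_complex T EL) n"
proof -
  interpret W: lozin V E x z b a y Z Y by (rule lozin_mirror)
  define S where "S = T \<inter> V"
  define P where "P = T \<inter> {y, z}"
  have S: "S \<subseteq> V - {x}" and SV: "S \<subseteq> V" "insert x S \<subseteq> V" and P: "P \<subseteq> {y, z}"
    using T x notin_V by (auto simp: S_def P_def lozin_verts_def)
  have fin: "finite T"
    using finite_subset[OF T] finite_V by (simp add: lozin_verts_def)
  have TS: "T = S \<union> P \<union> (T \<inter> {a, b})"
    using T by (auto simp: S_def P_def lozin_verts_def)
  have isolated: ?thesis if "v \<in> T" "\<And>u. u \<in> T \<Longrightarrow> {v, u} \<notin> EL" for v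
    using fin that by (rule null_homology_isolated)
  consider "a \<in> T" "b \<in> T" | "a \<in> T" "b \<notin> T" | "a \<notin> T" "b \<in> T" | "a \<notin> T" "b \<notin> T" by blast
  then show ?thesis
  proof cases
    case 1
    then have T': "T = S \<union> {a, b} \<union> P" using TS by auto
    consider "y \<notin> P" | "z \<notin> P" | "P = {y, z}" using P by blast
    then show ?thesis
    proof cases
      case 1
      then show ?thesis
        using null_homology_edge[OF S _ P, where 'k = 'k] old(2)[OF SV(1)] T' by simp
    next
      case 2
      have "P \<subseteq> {z, y}" "{b, a} = {a, b}" using P by auto
      then show ?thesis
        using 2 W.null_homology_edge[OF S, of P, where 'k = 'k] old(2)[OF SV(1)] T'
        by (simp add: lozin_edges_mirror)
    next
      case 3
      then have "T = S \<union> {y, a, b, z}" using T' by auto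
      then show ?thesis
        using null_homology_lozin[OF S, where 'k = 'k] old(2)[OF SV(2)] by simp
    qed
  next
    case 2
    show ?thesis
    proof (cases "y \<in> T")
      case True
      then have "T = S \<union> {y, a} \<union> (P - {y})" using TS 2 by (auto simp: P_def)
      then show ?thesis
        using null_homology_pendant[OF S _ old(2), of "P - {y}"] P by auto
    next
      case False
      then show ?thesis using 2 by (intro isolated[of a]) (auto simp: adj_a)
    qed
  next
    case 3
    show ?thesis
    proof (cases "z \<in> T")
      case True
      then have "T = S \<union> {z, b} \<union> (P - {z})" using TS 3 by (auto simp: P_def)
      then show ?thesis
        using W.null_homology_pendant[OF S _ old(2), of "P - {z}"] P
        by (auto simp: lozin_edges_mirror)
    next
      case False
      then show ?thesis using 3 by (intro isolated[of b]) (auto simp: adj_b)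
    qed
  next
    case 4
    then have "T = S \<union> P" using TS by auto
    then show ?thesis using null_homology_without_path[OF S P old] by simp
  qed
qed

section \<open>Comparing the nonzero degrees of the graph and its transform\<close>

lemma nonzero_degrees_lower:
  assumes "j \<in> nonzero_degrees TYPE('k::field) V E"
  shows "Suc j \<in> nonzero_degrees TYPE('k) (lozin_verts V x y a b z) EL"
proof -
  obtain S where S: "S \<subseteq> V" "\<not> null_homology TYPE('k) (independence_complex S E) (int j - 1)"
    using assms by (auto simp: nonzero_degrees_def)
  show ?thesis
  proof (cases "x \<in> S")
    case True
    then have "insert x (S - {x}) = S" by auto
    \<comment> \<open>The index \<open>j\<close> stands for degree \<open>int j - 1\<close>, so the
      shift by one leads to degree \<open>int j\<close>, that is, to the index
      \<open>Suc j\<close>.\<close>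
    then have "\<not> null_homology TYPE('k) (independence_complex (S - {x} \<union> {y, a, b, z}) EL) (int j)"
      using null_homology_lozin[of "S - {x}", where 'k = 'k] S by auto
    moreover have "S - {x} \<union> {y, a, b, z} \<subseteq> lozin_verts V x y a b z"
      using S(1) by (auto simp: lozin_verts_def)
    ultimately show ?thesis by (intro nonzero_degreesI) simp_all
  next
    case False
    then have "\<not> null_homology TYPE('k) (independence_complex (S \<union> {a, b} \<union> {}) EL) (int j)"
      using null_homology_edge[of S "{}", where 'k = 'k] S by auto
    moreover have "S \<union> {a, b} \<union> {} \<subseteq> lozin_verts V x y a b z"
      using S(1) False by (auto simp: lozin_verts_def)
    ultimately show ?thesis by (intro nonzero_degreesI) simp_all
  qed
qed

text \<open>Contraposition of \<open>null_homology_upper\<close> in degree \<open>j - 1\<close>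
  gives the index \<open>j\<close> or \<open>j - 1\<close> for the original graph. For
  \<open>j = 0\<close> there is no smaller index, and the element 0 serves instead.\<close>

lemma nonzero_degrees_upper:
  assumes "j \<in> nonzero_degrees TYPE('k::field) (lozin_verts V x y a b z) EL"
  shows "\<exists>i\<in>nonzero_degrees TYPE('k) V E. j \<le> Suc i"
proof (cases j)
  case 0
  then show ?thesis using zero_in_nonzero_degrees by auto
next
  case (Suc i)
  obtain T where "T \<subseteq> lozin_verts V x y a b z"
    "\<not> null_homology TYPE('k) (independence_complex T EL) (int i)"
    using assms Suc by (auto simp: nonzero_degrees_def)
  then obtain S where "S \<subseteq> V" "\<not> null_homology TYPE('k) (independence_complex S E) (int i) \<or>
      \<not> null_homology TYPE('k) (independence_complex S E) (int i - 1)"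
    using null_homology_upper[of T, where 'k = 'k] by blast
  then have "Suc i \<in> nonzero_degrees TYPE('k) V E \<or> i \<in> nonzero_degrees TYPE('k) V E"
    by (auto simp: nonzero_degrees_def)
  then show ?thesis
  proof
    assume "Suc i \<in> nonzero_degrees TYPE('k) V E"
    then show ?thesis using Suc by (intro bexI[of _ "Suc i"]) simp_all
  next
    assume "i \<in> nonzero_degrees TYPE('k) V E"
    then show ?thesis using Suc by (intro bexI[of _ i]) simp_all
  qed
qed

end

theorem theorem1p1:
  fixes V :: "'a set" and E :: "'a set set" and x y a b z :: 'a and Y Z :: "'a set"
  assumes "simple_graph V E"
    and "x \<in> V"
    and "Y \<union> Z = neighbourhood E x"
    and "Y \<inter> Z = {}"
    and "distinct [y, a, b, z]"
    and "{y, a, b, z} \<inter> V = {}"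
  shows "graph_reg TYPE('k::field) (lozin_verts V x y a b z) (lozin_edges E x Y Z y a b z) =
    graph_reg TYPE('k) V E + 1"
proof -
  interpret lozin V E x y a b z Y Z
    using assms by unfold_locales
  have fin: "finite (lozin_verts V x y a b z)" using finite_V by (simp add: lozin_verts_def)
  let ?N = "nonzero_degrees TYPE('k) V E"
  have "Max (nonzero_degrees TYPE('k) (lozin_verts V x y a b z) EL) = Suc (Max ?N)"
  proof (rule Max_eqI[OF finite_nonzero_degrees[OF fin]])
    show "Suc (Max ?N) \<in> nonzero_degrees TYPE('k) (lozin_verts V x y a b z) EL"
      using Max_in[OF finite_nonzero_degrees[OF finite_V]] zero_in_nonzero_degrees
      by (intro nonzero_degrees_lower) blast
  next
    fix j assume "j \<in> nonzero_degrees TYPE('k) (lozin_verts V x y a b z) EL"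
    then obtain i where "i \<in> ?N" "j \<le> Suc i" using nonzero_degrees_upper by blast
    then show "j \<le> Suc (Max ?N)"
      using Max_ge[OF finite_nonzero_degrees[OF finite_V]] by (meson Suc_le_mono le_trans)
  qed
  then show ?thesis by (simp add: graph_reg_eq_Max[OF fin] graph_reg_eq_Max[OF finite_V])
qed

end
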